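(* Consider the hybrid covariance steering problem described in the context, with an invertible jump matrix $\Xi\in\mathbb{R}^{n\times n}$. Denote the $n\times n$ blocks of the hybrid transition matrix over $[0,T]$ by $$\begin{bmatrix}\Phi^H_{11}&\Phi^H_{12}\\ \Phi^H_{21}&\Phi^H_{22}\end{bmatrix}\triangleq\begin{bmatrix}\Phi^H_{11}(T,0)&\Phi^H_{12}(T,0)\\ \Phi^H_{21}(T,0)&\Phi^H_{22}(T,0)\end{bmatrix}.$$ Then the initial conditions for the pair $(\Pi_j(t),H_j(t))$ that solves the hybrid covariance steering problem are $$\Pi_1(0)=\tfrac12\Sigma_0^{-1}-(\Phi^H_{12})^{-1}\Phi^H_{11}-\Sigma_0^{-\frac12}\Big(\tfrac{I}{4}+\Sigma_0^{\frac12}(\Phi^H_{12})^{-1}\Sigma_T\big((\Phi^H_{12})'\big)^{-1}\Sigma_0^{\frac12}\Big)^{\frac12}\Sigma_0^{-\frac12},$$ $$H_1(0)=\Sigma_0^{-1}-\Pi_1(0).$$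
   Context: A prime denotes transpose. The time window is $[0,T]$ with one jump event, at a time (determined by the controlled mean trajectory) written $t^-$ before the jump and $t^+$ after it, with $t^+=t^-$. Mode 1 is active on $[0,t^-]$ and mode 2 on $[t^+,T]$; $A_j(t)\in\mathbb{R}^{n\times n}$, $B_j(t)\in\mathbb{R}^{n\times m_j}$ are the system matrices and $Q_j(t)$ the running state cost in mode $j$. Hybrid covariance steering problem: minimize over the controls $u_j(t)\in\mathbb{R}^{m_j}$ $$\mathbb{E}\Big\{\int_0^T\big[\|u_j(t)\|^2+X_j'(t)Q_j(t)X_j(t)\big]dt\Big\}$$ ($j$ being the mode active at time $t$) subject to $dX_1=A_1X_1dt+B_1(u_1dt+\sqrt\epsilon\,dW_1)$ on $[0,t^-]$, $X_2(t^+)=\Xi X_1(t^-)$, $dX_2=A_2X_2dt+B_2(u_2dt+\sqrt\epsilon\,dW_2)$ on $[t^+,T]$, $X_1(0)\sim\mathcal N(m_0,\Sigma_0)$, $X_2(T)\sim\mathcal N(m_T,\Sigma_T)$, where $W_j$ are standard Wiener processes and $\epsilon$ is the noise intensity. Mean and covariance are controlled separately. The optimal covariance control has the feedback form $u_j(t)=-B_j'(t)\Pi_j(t)X_j(t)$. With $\Sigma_j(t)$ the controlled state covariance, $H_j(t)\triangleq\Sigma_j^{-1}(t)-\Pi_j(t)$. For invertible $\Xi$, solving the problem means solving for the pair $(\Pi_j(t),H_j(t))$, $j=1,2$, satisfying: in each mode, the Riccati equations $$-\dot\Pi_j=A_j'\Pi_j+\Pi_jA_j-\Pi_jB_jB_j'\Pi_j+Q_j,\qquad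 -\dot H_j=A_j'H_j+H_jA_j+H_jB_jB_j'H_j-Q_j;$$ at the jump, $\Pi_2(t^+)=(\Xi')^{-1}\Pi_1(t^-)\Xi^{-1}$ and $H_2(t^+)=(\Xi')^{-1}H_1(t^-)\Xi^{-1}$; the coupled boundary conditions $\Sigma_0^{-1}=\Pi_1(0)+H_1(0)$ and $\Sigma_T^{-1}=\Pi_2(T)+H_2(T)$. Transition kernels: $\Phi_j(t,s)\in\mathbb{R}^{2n\times2n}$ satisfies $\partial_t\Phi_j(t,s)=M_j(t)\Phi_j(t,s)$, $\Phi_j(s,s)=I$, with $M_j(t)=\begin{bmatrix}A_j(t)&-B_j(t)B_j'(t)\\-Q_j(t)&-A_j'(t)\end{bmatrix}$. The hybrid transition kernel is $\Phi^H(t,0)=\Phi_1(t,0)$ for $t\le t^-$ and $$\Phi^H(t,0)=\Phi_2(t,t^+)\begin{bmatrix}\Xi&0\\0&(\Xi')^{-1}\end{bmatrix}\Phi_1(t^-,0)\quad\text{for }t>t^-.$$ *)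

theory Defs
  imports "HOL-Analysis.Analysis"
begin

definition pos_semidef :: "real^'n^'n \<Rightarrow> bool" where
  "pos_semidef S \<longleftrightarrow> transpose S = S \<and> (\<forall>x. 0 \<le> x \<bullet> (S *v x))"

definition pos_def :: "real^'n^'n \<Rightarrow> bool" where
  "pos_def S \<longleftrightarrow> transpose S = S \<and> (\<forall>x. x \<noteq> 0 \<longrightarrow> 0 < x \<bullet> (S *v x))"

text \<open>The principal square root; meaningful only if the argument is positive semidefinite.\<close>

definition msqrt :: "real^'n^'n \<Rightarrow> real^'n^'n" where
  "msqrt S = (THE R. pos_semidef R \<and> R ** R = S)"

text \<open>The type \<^typ>\<open>real^('n + 'n)^('n + 'n)\<close> plays the role of the $2n \times 2n$ matrices; the
  left summand indexes the first $n$ rows or columns, the right summand the last $n$.\<close>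

definition block_matrix ::
    "real^'n^'n \<Rightarrow> real^'n^'n \<Rightarrow> real^'n^'n \<Rightarrow> real^'n^'n \<Rightarrow> real^('n + 'n)^('n + 'n)" where
  "block_matrix M11 M12 M21 M22 =
     (\<chi> i j. case i of
        Inl k \<Rightarrow> (case j of Inl l \<Rightarrow> M11 $ k $ l | Inr l \<Rightarrow> M12 $ k $ l)
      | Inr k \<Rightarrow> (case j of Inl l \<Rightarrow> M21 $ k $ l | Inr l \<Rightarrow> M22 $ k $ l))"

definition block11 :: "real^('n + 'n)^('n + 'n) \<Rightarrow> real^'n^'n" where
  "block11 M = (\<chi> i j. M $ Inl i $ Inl j)"

definition block12 :: "real^('n + 'n)^('n + 'n) \<Rightarrow> real^'n^'n" where
  "block12 M = (\<chi> i j. M $ Inl i $ Inr j)"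

definition hamiltonian_matrix ::
    "(real \<Rightarrow> real^'n^'n) \<Rightarrow> (real \<Rightarrow> real^'m^'n) \<Rightarrow> (real \<Rightarrow> real^'n^'n) \<Rightarrow>
     real \<Rightarrow> real^('n + 'n)^('n + 'n)" where
  "hamiltonian_matrix A B Q t =
     block_matrix (A t) (- (B t ** transpose (B t))) (- Q t) (- transpose (A t))"

text \<open>Derivatives are taken within the time interval \<open>I\<close>, i.e. one-sided at its end points.\<close>

definition transition_kernel ::
    "real set \<Rightarrow> (real \<Rightarrow> real^'k^'k) \<Rightarrow> (real \<Rightarrow> real \<Rightarrow> real^'k^'k) \<Rightarrow> bool" where
  "transition_kernel I M \<Phi> \<longleftrightarrow>
     (\<forall>s\<in>I. \<Phi> s s = mat 1 \<and>
        (\<forall>t\<in>I. ((\<lambda>r. \<Phi> r s) has_vector_derivative (M t ** \<Phi> t s)) (at t within I)))"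

text \<open>Here and below \<open>\<tau>\<close> is the jump time.  A function attached to mode 1 evaluated at \<open>\<tau>\<close> is its
  value at $t^-$, a function attached to mode 2 evaluated at \<open>\<tau>\<close> is its value at $t^+$.\<close>

definition hybrid_transition_kernel ::
    "real \<Rightarrow> real^'n^'n \<Rightarrow> (real \<Rightarrow> real \<Rightarrow> real^('n + 'n)^('n + 'n)) \<Rightarrow>
     (real \<Rightarrow> real \<Rightarrow> real^('n + 'n)^('n + 'n)) \<Rightarrow> real \<Rightarrow> real^('n + 'n)^('n + 'n)" where
  "hybrid_transition_kernel \<tau> \<Xi> \<Phi>\<^sub>1 \<Phi>\<^sub>2 t =
     (if t \<le> \<tau> then \<Phi>\<^sub>1 t 0
      else \<Phi>\<^sub>2 t \<tau> ** block_matrix \<Xi> 0 0 (matrix_inv (transpose \<Xi>)) ** \<Phi>\<^sub>1 \<tau> 0)"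

definition riccati_pair_on ::
    "real set \<Rightarrow> (real \<Rightarrow> real^'n^'n) \<Rightarrow> (real \<Rightarrow> real^'m^'n) \<Rightarrow> (real \<Rightarrow> real^'n^'n) \<Rightarrow>
     (real \<Rightarrow> real^'n^'n) \<Rightarrow> (real \<Rightarrow> real^'n^'n) \<Rightarrow> bool" where
  "riccati_pair_on I A B Q P H \<longleftrightarrow>
     (\<forall>t\<in>I.
        (P has_vector_derivative
           - (transpose (A t) ** P t + P t ** A t
              - P t ** B t ** transpose (B t) ** P t + Q t)) (at t within I) \<and>
        (H has_vector_derivative
           - (transpose (A t) ** H t + H t ** A t
              + H t ** B t ** transpose (B t) ** H t - Q t)) (at t within I))"

definition jump_condition :: "real^'n^'n \<Rightarrow> real^'n^'n \<Rightarrow> real^'n^'n \<Rightarrow> bool" where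
  "jump_condition \<Xi> P\<^sub>1 P\<^sub>2 \<longleftrightarrow> P\<^sub>2 = matrix_inv (transpose \<Xi>) ** P\<^sub>1 ** matrix_inv \<Xi>"

definition hybrid_riccati_flow ::
    "real \<Rightarrow> real \<Rightarrow> real^'n^'n \<Rightarrow>
     (real \<Rightarrow> real^'n^'n) \<Rightarrow> (real \<Rightarrow> real^'p^'n) \<Rightarrow> (real \<Rightarrow> real^'n^'n) \<Rightarrow>
     (real \<Rightarrow> real^'n^'n) \<Rightarrow> (real \<Rightarrow> real^'q^'n) \<Rightarrow> (real \<Rightarrow> real^'n^'n) \<Rightarrow>
     (real \<Rightarrow> real^'n^'n) \<Rightarrow> (real \<Rightarrow> real^'n^'n) \<Rightarrow>
     (real \<Rightarrow> real^'n^'n) \<Rightarrow> (real \<Rightarrow> real^'n^'n) \<Rightarrow> bool" where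
  "hybrid_riccati_flow \<tau> T \<Xi> A\<^sub>1 B\<^sub>1 Q\<^sub>1 A\<^sub>2 B\<^sub>2 Q\<^sub>2 P\<^sub>1 H\<^sub>1 P\<^sub>2 H\<^sub>2 \<longleftrightarrow>
     riccati_pair_on {0..\<tau>} A\<^sub>1 B\<^sub>1 Q\<^sub>1 P\<^sub>1 H\<^sub>1 \<and>
     riccati_pair_on {\<tau>..T} A\<^sub>2 B\<^sub>2 Q\<^sub>2 P\<^sub>2 H\<^sub>2 \<and>
     jump_condition \<Xi> (P\<^sub>1 \<tau>) (P\<^sub>2 \<tau>) \<and>
     jump_condition \<Xi> (H\<^sub>1 \<tau>) (H\<^sub>2 \<tau>)"

text \<open>The pair consists of symmetric matrices: \<open>P\<close> is the quadratic form of the value function, and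
  \<open>H\<close> is the difference of the inverse of a covariance matrix and \<open>P\<close>.\<close>

definition solves_hybrid_covariance_steering ::
    "real \<Rightarrow> real \<Rightarrow> real^'n^'n \<Rightarrow>
     (real \<Rightarrow> real^'n^'n) \<Rightarrow> (real \<Rightarrow> real^'p^'n) \<Rightarrow> (real \<Rightarrow> real^'n^'n) \<Rightarrow>
     (real \<Rightarrow> real^'n^'n) \<Rightarrow> (real \<Rightarrow> real^'q^'n) \<Rightarrow> (real \<Rightarrow> real^'n^'n) \<Rightarrow>
     real^'n^'n \<Rightarrow> real^'n^'n \<Rightarrow>
     (real \<Rightarrow> real^'n^'n) \<Rightarrow> (real \<Rightarrow> real^'n^'n) \<Rightarrow>
     (real \<Rightarrow> real^'n^'n) \<Rightarrow> (real \<Rightarrow> real^'n^'n) \<Rightarrow> bool" where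
  "solves_hybrid_covariance_steering \<tau> T \<Xi> A\<^sub>1 B\<^sub>1 Q\<^sub>1 A\<^sub>2 B\<^sub>2 Q\<^sub>2 \<Sigma>\<^sub>0 \<Sigma>\<^sub>T P\<^sub>1 H\<^sub>1 P\<^sub>2 H\<^sub>2 \<longleftrightarrow>
     (\<forall>t\<in>{0..\<tau>}. transpose (P\<^sub>1 t) = P\<^sub>1 t \<and> transpose (H\<^sub>1 t) = H\<^sub>1 t) \<and>
     (\<forall>t\<in>{\<tau>..T}. transpose (P\<^sub>2 t) = P\<^sub>2 t \<and> transpose (H\<^sub>2 t) = H\<^sub>2 t) \<and>
     hybrid_riccati_flow \<tau> T \<Xi> A\<^sub>1 B\<^sub>1 Q\<^sub>1 A\<^sub>2 B\<^sub>2 Q\<^sub>2 P\<^sub>1 H\<^sub>1 P\<^sub>2 H\<^sub>2 \<and>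
     matrix_inv \<Sigma>\<^sub>0 = P\<^sub>1 0 + H\<^sub>1 0 \<and>
     matrix_inv \<Sigma>\<^sub>T = P\<^sub>2 T + H\<^sub>2 T"

end

theory Submission
  imports Defs
begin

text \<open>Both \<open>\<Pi>\<close> and \<open>K = - H\<close> satisfy the same Riccati equation, and a solution \<open>P\<close> of it is the
  same thing as an invariant family of graphs \<open>l = P x\<close> of the linear Hamiltonian system, whose
  flow (including the jump) preserves the symplectic form \<open>x \<bullet> l' - l \<bullet> x'\<close>.  With
  \<open>Z = \<Pi>(0) + F12\<inverse> F11\<close> the closed-loop states at time \<open>T\<close> are \<open>F12 Z\<close> and
  \<open>F12 (Z - \<Sigma>\<^sub>0\<inverse>)\<close>, and invariance of the form turns the terminal condition into the quadratic
  equation \<open>Z \<Sigma>\<^sub>0 Z - Z = F12\<inverse> \<Sigma>\<^sub>T F12'\<inverse>\<close>, i.e. \<open>(I/2 - \<Sigma>\<^sub>0\<^bsup>1/2\<^esup> Z \<Sigma>\<^sub>0\<^bsup>1/2\<^esup>)\<^sup>2\<close> is the matrix under the root.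
  The root is the principal one because \<open>Z \<le> 0\<close> whenever the Riccati solution exists on all of
  \<open>[0, T]\<close>: \<open>y \<bullet> (l - P y)\<close> is nonincreasing along trajectories.  Conversely, \<open>Z < 0\<close> and
  \<open>Q \<ge> 0\<close> exclude a focal point in \<open>[0, T]\<close>, since then \<open>x \<bullet> l\<close> is nonincreasing along trajectories.\<close>

section \<open>Matrices\<close>

text \<open>As a simp rule it would turn \<open>transpose A *v x\<close> into \<open>x v* A\<close>,
  whereas adjoints are moved across inner products in the \<open>transpose\<close> form
  below.\<close>

declare transpose_matrix_vector [simp del]

text \<open>The difference quotient is the form in which the resolvent identity for
  \<open>matrix_inv\<close> can be differentiated.\<close>

lemma has_vector_derivative_iff_quotient:
  "(f has_vector_derivative D) (at t within I) \<longleftrightarrow>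
    ((\<lambda>s. (f s - f t) /\<^sub>R (s - t)) \<longlongrightarrow> D) (at t within I)"
proof -
  have "norm (f s - f t - (s - t) *\<^sub>R D) / norm (s - t) = norm ((f s - f t) /\<^sub>R (s - t) - D)"
    if "s \<noteq> t" for s
  proof -
    have "(f s - f t) /\<^sub>R (s - t) - D = (f s - f t - (s - t) *\<^sub>R D) /\<^sub>R (s - t)"
      using that by (simp add: scaleR_diff_right)
    then show ?thesis by (simp add: divide_inverse)
  qed
  then have "(\<forall>\<^sub>F s in at t within I.
      norm (f s - f t - (s - t) *\<^sub>R D) / norm (s - t) = norm ((f s - f t) /\<^sub>R (s - t) - D))"
    by (auto simp: eventually_at_filter)
  then have "((\<lambda>s. norm (f s - f t - (s - t) *\<^sub>R D) / norm (s - t)) \<longlongrightarrow> 0) (at t within I) \<longleftrightarrow>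
      ((\<lambda>s. norm ((f s - f t) /\<^sub>R (s - t) - D)) \<longlongrightarrow> 0) (at t within I)"
    by (rule tendsto_cong)
  then show ?thesis
    by (simp add: has_vector_derivative_def has_derivative_iff_norm bounded_linear_scaleR_left
        tendsto_norm_zero_iff LIM_zero_iff)
qed

section \<open>Bilinearity of the matrix products and adjoints\<close>

lemma bounded_bilinear_matrix_mult:
  "bounded_bilinear ((**) :: real^'n^'m \<Rightarrow> real^'p^'n \<Rightarrow> real^'p^'m)"
  unfolding bilinear_conv_bounded_bilinear [symmetric] bilinear_def
  by (auto intro!: linearI simp: matrix_add_ldistrib vec_eq_iff matrix_matrix_mult_def
      sum.distrib sum_distrib_left algebra_simps)

lemma bounded_bilinear_matrix_vector_mult:
  "bounded_bilinear ((*v) :: real^'n^'m \<Rightarrow> real^'n \<Rightarrow> real^'m)"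
  unfolding bilinear_conv_bounded_bilinear [symmetric] bilinear_def
  by (auto intro!: linearI simp: algebra_simps scaleR_matrix_vector_assoc)

interpretation mat_mult: bounded_bilinear "(**) :: real^'n^'m \<Rightarrow> real^'p^'n \<Rightarrow> real^'p^'m"
  by (rule bounded_bilinear_matrix_mult)

interpretation mat_vec: bounded_bilinear "(*v) :: real^'n^'m \<Rightarrow> real^'n \<Rightarrow> real^'m"
  by (rule bounded_bilinear_matrix_vector_mult)

lemma bounded_linear_transpose: "bounded_linear (transpose :: real^'n^'m \<Rightarrow> real^'m^'n)"
  unfolding linear_conv_bounded_linear [symmetric]
  by (auto intro!: linearI simp: transpose_def vec_eq_iff)

lemma inner_matrix_vector: "(x::real^'m) \<bullet> (A *v y) = (transpose A *v x) \<bullet> y"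
  by (simp add: transpose_matrix_vector dot_lmul_matrix)

lemma inner_transpose: "x \<bullet> (transpose A *v y) = (A *v x) \<bullet> y" for A :: "real^'n^'m"
  by (metis inner_commute inner_matrix_vector transpose_transpose)

lemma inner_symmetric_matrix: "transpose S = S \<Longrightarrow> x \<bullet> (S *v y) = (S *v x) \<bullet> y" for S :: "real^'n^'n"
  using inner_transpose[of x S y] by simp

text \<open>\<open>matrix_inv\<close> is a chosen two-sided inverse. A one-sided inverse of a square
  matrix is two-sided, so the choice has the witness \<open>B\<close>, and associativity identifies
  the two.\<close>

lemma matrix_inv_unique:
  fixes A :: "real^'n^'n"
  assumes "A ** B = mat 1"
  shows "matrix_inv A = B"
proof -
  have BA: "B ** A = mat 1" using assms by (simp add: matrix_left_right_inverse)
  have "A ** matrix_inv A = mat 1"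
    unfolding matrix_inv_def by (rule someI2 [of _ B]) (use assms BA in auto)
  then have "B ** (A ** matrix_inv A) = B" by simp
  then show ?thesis by (simp add: matrix_mul_assoc BA)
qed

lemma matrix_inv_right [simp]: "invertible A \<Longrightarrow> A ** matrix_inv A = mat 1" for A :: "real^'n^'n"
  by (metis invertible_def matrix_inv_unique)

lemma matrix_inv_left [simp]: "invertible A \<Longrightarrow> matrix_inv A ** A = mat 1" for A :: "real^'n^'n"
  by (simp add: matrix_left_right_inverse)

lemma invertible_matrix_inv: "invertible A \<Longrightarrow> invertible (matrix_inv A)" for A :: "real^'n^'n"
  by (metis invertible_def matrix_inv_left matrix_inv_right)

lemma matrix_inv_transpose: "invertible A \<Longrightarrow> matrix_inv (transpose A) = transpose (matrix_inv A)"
  for A :: "real^'n^'n"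
  by (metis matrix_inv_left matrix_inv_unique matrix_transpose_mul transpose_mat)

lemma invertible_if_ker_trivial:
  fixes A :: "real^'n^'n"
  assumes "\<And>x. A *v x = 0 \<Longrightarrow> x = 0"
  shows "invertible A"
  using assms by (auto simp: invertible_left_inverse matrix_left_invertible_ker)

lemma invertible_mult_vector_eq_0: "invertible A \<Longrightarrow> A *v x = 0 \<Longrightarrow> x = 0" for A :: "real^'n^'n"
  by (auto simp: invertible_left_inverse matrix_left_invertible_ker)

text \<open>The resolvent identity \<open>R - S = - R (X - L) S\<close> bounds the error by
  \<open>norm R\<close> times a quantity tending to 0, so it remains to bound
  \<open>norm R\<close>.\<close>

lemma tendsto_matrix_inv:
  fixes X :: "'a \<Rightarrow> real^'n^'n"
  assumes lim: "(X \<longlongrightarrow> L) F" and L: "invertible L" and inv: "\<forall>\<^sub>F s in F. invertible (X s)"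
  shows "((\<lambda>s. matrix_inv (X s)) \<longlongrightarrow> matrix_inv L) F"
proof -
  obtain K where K: "K > 0" "\<And>(a::real^'n^'n) (b::real^'n^'n). norm (a ** b) \<le> norm a * norm b * K"
    using mat_mult.pos_bounded by blast
  let ?R = "\<lambda>s. matrix_inv (X s)" and ?S = "matrix_inv L"
  let ?d = "\<lambda>s. norm ((X s - L) ** ?S) * K"
  have d: "(?d \<longlongrightarrow> 0) F"
    using lim by (auto intro!: tendsto_eq_intros mat_mult.tendsto simp: mat_mult.zero_left LIM_zero)
  have diff: "\<forall>\<^sub>F s in F. norm (?R s - ?S) \<le> norm (?R s) * ?d s"
    using inv
  proof eventually_elim
    case (elim s)
    have "?R s - ?S = - (?R s ** ((X s - L) ** ?S))"
      using elim L by (simp add: mat_mult.diff_left mat_mult.diff_right matrix_mul_assoc)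
    then show ?case using K(2)[of "?R s" "(X s - L) ** ?S"] by (simp add: mult_ac)
  qed
  have "\<forall>\<^sub>F s in F. ?d s < 1/2"
    using d by (rule order_tendstoD) simp
  \<comment> \<open>As soon as \<open>?d s\<close> is below 1/2, the triangle inequality absorbs
    half of \<open>norm (?R s)\<close>, which bounds the inverses near the limit.\<close>
  with diff have bd: "\<forall>\<^sub>F s in F. norm (?R s - ?S) \<le> 2 * norm ?S * ?d s"
  proof eventually_elim
    case (elim s)
    have "norm (?R s) * ?d s \<le> norm (?R s) * (1/2)"
      using elim by (intro mult_left_mono) auto
    with elim(1) have "norm (?R s) \<le> norm ?S + norm (?R s) * (1/2)"
      using norm_triangle_sub[of "?R s" ?S] by linarith
    then have "norm (?R s) \<le> 2 * norm ?S" by simp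
    then have "norm (?R s) * ?d s \<le> 2 * norm ?S * ?d s"
      using K(1) by (intro mult_right_mono) auto
    with elim show ?case by linarith
  qed
  have "((\<lambda>s. 2 * norm ?S * ?d s) \<longlongrightarrow> 0) F" using tendsto_mult_right_zero[OF d] .
  then have "((\<lambda>s. ?R s - ?S) \<longlongrightarrow> 0) F"
    by (rule Lim_null_comparison[OF bd])
  then show ?thesis by (simp add: LIM_zero_iff)
qed

text \<open>This is the resolvent identity between \<open>s\<close> and \<open>t\<close>, divided by
  \<open>s - t\<close>; continuity of the inverse supplies the limit of the left factor.\<close>

lemma has_vector_derivative_matrix_inv:
  fixes X :: "real \<Rightarrow> real^'n^'n"
  assumes X: "(X has_vector_derivative X') (at t within I)" and t: "t \<in> I"
    and inv: "\<And>s. s \<in> I \<Longrightarrow> invertible (X s)"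
  shows "((\<lambda>s. matrix_inv (X s)) has_vector_derivative
      - (matrix_inv (X t) ** X' ** matrix_inv (X t))) (at t within I)"
proof -
  let ?R = "\<lambda>s. matrix_inv (X s)"
  have ev: "\<forall>\<^sub>F s in at t within I. s \<in> I \<and> s \<noteq> t"
    by (simp add: eventually_at_filter)
  have "(X \<longlongrightarrow> X t) (at t within I)"
    using has_vector_derivative_continuous[OF X] by (simp add: continuous_within)
  then have R: "(?R \<longlongrightarrow> ?R t) (at t within I)"
    using inv t ev by (intro tendsto_matrix_inv) (auto elim: eventually_mono)
  have X2: "((\<lambda>s. (X s - X t) /\<^sub>R (s - t)) \<longlongrightarrow> X') (at t within I)"
    using X by (simp add: has_vector_derivative_iff_quotient)
  have "((\<lambda>s. - (?R s ** ((X s - X t) /\<^sub>R (s - t)) ** ?R t)) \<longlongrightarrow> - (?R t ** X' ** ?R t)) (at t within I)"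
    by (intro tendsto_intros mat_mult.tendsto R X2)
  moreover have "\<forall>\<^sub>F s in at t within I. - (?R s ** ((X s - X t) /\<^sub>R (s - t)) ** ?R t) = (?R s - ?R t) /\<^sub>R (s - t)"
    using ev
  proof eventually_elim
    case (elim s)
    have "?R s ** (X s - X t) ** ?R t = ?R t - ?R s"
      using elim t inv by (simp add: mat_mult.diff_left mat_mult.diff_right)
        (simp flip: matrix_mul_assoc add: inv)
    then show ?case by (simp add: mat_mult.scaleR_left mat_mult.scaleR_right flip: scaleR_minus_right)
  qed
  ultimately have "((\<lambda>s. (?R s - ?R t) /\<^sub>R (s - t)) \<longlongrightarrow> - (?R t ** X' ** ?R t)) (at t within I)"
    by (rule Lim_transform_eventually)
  then show ?thesis by (simp add: has_vector_derivative_iff_quotient)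
qed

section \<open>Spectral theorem and principal square roots\<close>

text \<open>A maximizer of the Rayleigh quotient on the unit sphere of \<open>V\<close> is an
  eigenvector: the quotient cannot grow in the direction of the residual
  \<open>w = S v - c v\<close>, which lies in \<open>V\<close> by invariance.\<close>

lemma symmetric_maximizer_eigenvector:
  fixes S :: "real^'n^'n"
  assumes S: "transpose S = S" and V: "subspace V" and inv: "\<And>x. x \<in> V \<Longrightarrow> S *v x \<in> V"
    and ne: "\<exists>x\<in>V. x \<noteq> 0"
  obtains v c where "v \<in> V" "norm v = 1" "S *v v = c *\<^sub>R v"
proof -
  let ?K = "V \<inter> sphere 0 1"
  let ?q = "\<lambda>x. x \<bullet> (S *v x)"
  obtain x where x: "x \<in> V" "x \<noteq> 0" using ne by blast
  have "x /\<^sub>R norm x \<in> ?K" using x V by (simp add: subspace_scale)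
  then have "?K \<noteq> {}" by blast
  moreover have "compact ?K"
    using closed_subspace[OF V] by (intro closed_Int_compact) auto
  moreover have "continuous_on ?K ?q"
    by (intro continuous_intros mat_vec.continuous_on)
  ultimately obtain v where "v \<in> ?K" and max: "\<And>y. y \<in> ?K \<Longrightarrow> ?q y \<le> ?q v"
    using continuous_attains_sup[of ?K ?q] by blast
  then have v: "v \<in> V" "norm v = 1" by auto
  define c where "c = ?q v"
  have le: "?q u \<le> c * (u \<bullet> u)" if u: "u \<in> V" for u
  proof (cases "u = 0")
    case False
    have "u /\<^sub>R norm u \<in> ?K" using u V False by (simp add: subspace_scale)
    from max[OF this] have "?q u / (norm u * norm u) \<le> c"
      by (simp add: c_def mat_vec.scaleR_right field_simps)
    then show ?thesis using False by (simp add: field_simps dot_square_norm power2_eq_square)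
  qed simp
  define w where "w = S *v v - c *\<^sub>R v"
  have w: "w \<in> V" using v V inv by (simp add: w_def subspace_diff subspace_scale)
  have sym: "w \<bullet> (S *v v) = v \<bullet> (S *v w)"
    by (simp add: inner_symmetric_matrix[OF S, of w v] inner_commute)
  define b where "b = ?q w - c * (w \<bullet> w)"
  \<comment> \<open>Maximality tested at \<open>v + e w\<close>: what survives is a term linear in
    \<open>e\<close> with coefficient \<open>2 * (w \<bullet> w)\<close> and a quadratic
    one.\<close>
  have key: "2 * e * (w \<bullet> w) + e\<^sup>2 * b \<le> 0" for e :: real
  proof -
    have "v + e *\<^sub>R w \<in> V" using v w V by (simp add: subspace_add subspace_scale)
    from le[OF this]
    have "?q v + 2 * e * (w \<bullet> (S *v v)) + e\<^sup>2 * ?q w \<le> c * (v \<bullet> v + 2 * e * (w \<bullet> v) + e\<^sup>2 * (w \<bullet> w))"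
      by (simp add: mat_vec.add_right mat_vec.scaleR_right inner_add_left inner_add_right sym
          inner_commute power2_eq_square algebra_simps)
    moreover have "v \<bullet> v = 1" using v by (simp add: dot_square_norm)
    moreover have "w \<bullet> (S *v v) = w \<bullet> w + c * (w \<bullet> v)"
      by (subst (3) w_def) (simp add: inner_diff_right)
    ultimately have "c + 2 * e * (w \<bullet> w + c * (w \<bullet> v)) + e\<^sup>2 * ?q w
        \<le> c * (1 + 2 * e * (w \<bullet> v) + e\<^sup>2 * (w \<bullet> w))"
      by (simp add: c_def)
    then show ?thesis by (simp add: b_def algebra_simps)
  qed
  have "w \<bullet> w = 0"
  proof (rule ccontr)
    assume "w \<bullet> w \<noteq> 0"
    then have pos: "w \<bullet> w > 0" by simp
    \<comment> \<open>Small enough that \<open>e * \<bar>b\<bar>\<close> is at most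
      \<open>w \<bullet> w\<close>, so the linear term wins; the 1 in the denominator covers
      \<open>b = 0\<close>.\<close>
    define e where "e = (w \<bullet> w) / (\<bar>b\<bar> + 1)"
    have e: "e > 0" using pos by (simp add: e_def add_nonneg_pos)
    have "e * (2 * (w \<bullet> w) + e * b) \<le> 0" using key[of e] by (simp add: power2_eq_square algebra_simps)
    then have "2 * (w \<bullet> w) + e * b \<le> 0" using e by (simp add: mult_le_0_iff)
    moreover have "- (w \<bullet> w) \<le> e * b"
    proof -
      have "e * \<bar>b\<bar> \<le> w \<bullet> w"
        using pos by (simp add: e_def divide_le_eq add_nonneg_pos algebra_simps)
      moreover have "- (e * \<bar>b\<bar>) \<le> e * b" using e by (simp add: abs_if)
      ultimately show ?thesis by linarith
    qed
    ultimately show False using pos by linarith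
  qed
  then have "S *v v = c *\<^sub>R v" by (simp add: w_def)
  with v that show ?thesis by blast
qed

text \<open>An orthonormal set of eigenvectors of maximal size spans: its orthogonal complement is
  invariant under the symmetric \<open>S\<close>, so a nonzero complement would contain a further
  unit eigenvector.\<close>

lemma symmetric_orthonormal_eigenbasis:
  fixes S :: "real^'n^'n"
  assumes S: "transpose S = S"
  obtains E c where "finite E" "pairwise orthogonal E" "\<And>e. e \<in> E \<Longrightarrow> norm e = 1"
    "\<And>e. e \<in> E \<Longrightarrow> S *v e = c e *\<^sub>R e" "span E = UNIV"
proof -
  let ?P = "\<lambda>E. pairwise orthogonal E \<and> (\<forall>e\<in>E. norm e = 1 \<and> (\<exists>c. S *v e = c *\<^sub>R e))"
  have ind: "independent E" if "?P E" for E
    using that by (intro pairwise_orthogonal_independent) auto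
  have "card E < Suc (DIM(real^'n))" if "?P E" for E
    using independent_bound[OF ind[OF that]] by (simp add: less_Suc_eq_le)
  \<comment> \<open>Orthonormal sets are independent, so the dimension bounds their size and a
    largest one exists.\<close>
  then have "\<exists>E. ?P E \<and> (\<forall>D. ?P D \<longrightarrow> card D \<le> card E)"
    by (intro Lattices_Big.ex_has_greatest_nat[of ?P "{}" card "Suc (DIM(real^'n))"]) auto
  then obtain E where E: "?P E" and max: "\<And>D. ?P D \<Longrightarrow> card D \<le> card E"
    by blast
  have fin: "finite E" using ind[OF E] by (rule independent_imp_finite)
  have "span E = UNIV"
  proof (rule ccontr)
    assume *: "span E \<noteq> UNIV"
    then have "dim E < DIM(real^'n)"
      by (metis dim_eq_full dim_subset_UNIV le_neq_implies_less)
    then obtain x where x: "x \<noteq> 0" "\<And>y. y \<in> span E \<Longrightarrow> orthogonal x y"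
      by (rule orthogonal_to_subspace_exists) blast
    define V where "V = {x. \<forall>e\<in>E. e \<bullet> x = 0}"
    have V: "subspace V" by (auto simp: V_def subspace_def inner_add_right)
    have "x \<in> V" using x by (auto simp: V_def orthogonal_def span_base inner_commute)
    moreover have "S *v y \<in> V" if y: "y \<in> V" for y
      unfolding V_def
    proof (intro CollectI ballI)
      fix e assume e: "e \<in> E"
      then obtain c where c: "S *v e = c *\<^sub>R e" using E by blast
      have "e \<bullet> (S *v y) = (S *v e) \<bullet> y" by (rule inner_symmetric_matrix[OF S])
      then show "e \<bullet> (S *v y) = 0" using c y e by (simp add: V_def)
    qed
    ultimately obtain v c where v: "v \<in> V" "norm v = 1" "S *v v = c *\<^sub>R v"
      using symmetric_maximizer_eigenvector[OF S V] x(1) by blast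
    have "v \<notin> E"
    proof
      assume "v \<in> E"
      then have "v \<bullet> v = 0" using v by (simp add: V_def)
      then show False using v by simp
    qed
    moreover have "?P (insert v E)"
      using E v by (auto simp: pairwise_insert V_def orthogonal_def inner_commute)
    then have "card (insert v E) \<le> card E" by (rule max)
    ultimately show False using fin by simp
  qed
  moreover have "\<forall>e\<in>E. \<exists>c. S *v e = c *\<^sub>R e" using E by simp
  then obtain c where "\<forall>e\<in>E. S *v e = c e *\<^sub>R e" by (rule bchoice [THEN exE])
  ultimately show ?thesis using that[of E c] E fin by simp
qed

text \<open>The residual is orthogonal to every basis vector, hence to the whole space and to
  itself.\<close>

lemma orthonormal_basis_expansion:
  fixes x :: "'a::euclidean_space"
  assumes fin: "finite E" and orth: "pairwise orthogonal E" and norm: "\<And>e. e \<in> E \<Longrightarrow> norm e = 1"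
    and span: "span E = UNIV"
  shows "(\<Sum>e\<in>E. (x \<bullet> e) *\<^sub>R e) = x"
proof -
  let ?y = "x - (\<Sum>e\<in>E. (x \<bullet> e) *\<^sub>R e)"
  have "?y \<bullet> f = 0" if f: "f \<in> E" for f
  proof -
    have "(\<Sum>e\<in>E. (x \<bullet> e) *\<^sub>R e) \<bullet> f = (\<Sum>e\<in>E. if e = f then x \<bullet> f else 0)"
      unfolding inner_sum_left
      by (rule sum.cong) (use orth norm f in \<open>auto simp: pairwise_def orthogonal_def dot_square_norm\<close>)
    then show ?thesis using fin f by (simp add: inner_diff_left)
  qed
  then have "orthogonal ?y f" if "f \<in> E" for f
    using that unfolding orthogonal_def by blast
  then have "orthogonal ?y ?y"
    using span by (intro orthogonal_to_span[of ?y E]) auto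
  then show ?thesis by (simp add: orthogonal_def)
qed

lemma matrix_eq_on_span:
  fixes A B :: "real^'n^'m"
  assumes "\<And>e. e \<in> E \<Longrightarrow> A *v e = B *v e" and "span E = UNIV"
  shows "A = B"
proof -
  have "A *v x = B *v x" for x
  proof (rule linear_eq_on_span[of "(*v) A" "(*v) B" E])
    show "x \<in> span E" by (subst assms(2)) (rule UNIV_I)
  qed (simp_all add: assms(1))
  then show ?thesis by (simp add: matrix_eq)
qed

text \<open>In an orthonormal eigenbasis of \<open>S\<close> one takes the square roots of the
  eigenvalues.\<close>

lemma pos_semidef_sqrt_exists:
  assumes "pos_semidef S"
  shows "\<exists>R. pos_semidef R \<and> R ** R = S"
proof -
  have S: "transpose S = S" "\<And>x. 0 \<le> x \<bullet> (S *v x)" using assms by (auto simp: pos_semidef_def)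
  obtain E c where E: "finite E" "pairwise orthogonal E" "\<And>e. e \<in> E \<Longrightarrow> norm e = 1"
    "\<And>e. e \<in> E \<Longrightarrow> S *v e = c e *\<^sub>R e" "span E = UNIV"
    using symmetric_orthonormal_eigenbasis[OF S(1)] by blast
  have c: "c e \<ge> 0" if "e \<in> E" for e
    using S(2)[of e] E(3,4)[OF that] by (simp add: dot_square_norm)
  define r where "r x = (\<Sum>e\<in>E. (sqrt (c e) * (x \<bullet> e)) *\<^sub>R e)" for x
  define R where "R = matrix r"
  have "linear r"
    by (rule linearI) (auto simp: r_def inner_add_left algebra_simps sum.distrib scaleR_sum_right)
  then have Rr: "R *v x = r x" for x by (simp add: R_def matrix_works)
  have ee: "e \<bullet> f = (if e = f then 1 else 0)" if "e \<in> E" "f \<in> E" for e f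
    using E(2,3) that by (auto simp: pairwise_def orthogonal_def dot_square_norm)
  have Re: "R *v f = sqrt (c f) *\<^sub>R f" if f: "f \<in> E" for f
  proof -
    have "r f = (\<Sum>e\<in>E. if e = f then sqrt (c f) *\<^sub>R f else 0)"
      unfolding r_def by (rule sum.cong) (use ee f in auto)
    then show ?thesis using E(1) f by (simp add: Rr)
  qed
  have xR: "y \<bullet> (R *v x) = (\<Sum>e\<in>E. sqrt (c e) * (x \<bullet> e) * (y \<bullet> e))" for x y
    by (simp add: Rr r_def inner_sum_right)
  have "(transpose R *v y) \<bullet> x = (R *v y) \<bullet> x" for x y
    by (subst inner_matrix_vector [symmetric])
      (simp add: xR inner_commute[of "R *v y" x] mult_ac)
  then have "transpose R *v y = R *v y" for y
    using vector_eq_rdot by blast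
  then have "transpose R = R" by (simp only: matrix_eq) blast
  moreover have "0 \<le> x \<bullet> (R *v x)" for x
    unfolding xR by (intro sum_nonneg) (use c in \<open>auto simp: mult.assoc\<close>)
  moreover have "R ** R = S"
    by (rule matrix_eq_on_span[OF _ E(5)])
      (use c E(4) in \<open>auto simp: Re mat_vec.scaleR_right simp flip: matrix_vector_mul_assoc\<close>)
  ultimately show ?thesis by (auto simp: pos_semidef_def)
qed

text \<open>For an eigenvector \<open>e\<close> of \<open>R\<close> with eigenvalue
  \<open>c \<ge> 0\<close>, equality of the squares gives \<open>(R' + c) (R' - c) e = 0\<close>. If
  \<open>c > 0\<close>, then \<open>R' + c\<close> is injective because \<open>R'\<close> is
  positive semidefinite; if \<open>c = 0\<close>, the norm of \<open>R' e\<close> vanishes. Either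
  way \<open>R' e = c e\<close>.\<close>

lemma pos_semidef_sqrt_unique:
  assumes R: "pos_semidef R" and R': "pos_semidef R'" and eq: "R ** R = R' ** R'"
  shows "R = R'"
proof -
  have R1: "transpose R = R" "\<And>x. 0 \<le> x \<bullet> (R *v x)" using R by (auto simp: pos_semidef_def)
  have R2: "transpose R' = R'" "\<And>x. 0 \<le> x \<bullet> (R' *v x)" using R' by (auto simp: pos_semidef_def)
  obtain E c where "finite E" "pairwise orthogonal E" and E: "\<And>e. e \<in> E \<Longrightarrow> norm e = 1"
    "\<And>e. e \<in> E \<Longrightarrow> R *v e = c e *\<^sub>R e" "span E = UNIV"
    using symmetric_orthonormal_eigenbasis[OF R1(1)] by blast
  show ?thesis
  proof (rule matrix_eq_on_span[OF _ E(3)])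
    fix e assume e: "e \<in> E"
    have c: "c e \<ge> 0" using R1(2)[of e] E(1,2)[OF e] by (simp add: dot_square_norm)
    have "R *v (R *v e) = R' *v (R' *v e)" using eq by (simp add: matrix_vector_mul_assoc)
    then have sq: "R' *v (R' *v e) = (c e)\<^sup>2 *\<^sub>R e"
      by (simp add: E(2)[OF e] mat_vec.scaleR_right power2_eq_square)
    define d where "d = R' *v e - c e *\<^sub>R e"
    have d: "R' *v d = - c e *\<^sub>R d"
      by (simp add: d_def mat_vec.diff_right mat_vec.scaleR_right sq scaleR_diff_right power2_eq_square)
    have "d = 0"
    proof (cases "c e = 0")
      case True
      have "(R' *v e) \<bullet> (R' *v e) = e \<bullet> (R' *v (R' *v e))"
        by (rule inner_symmetric_matrix[OF R2(1), symmetric])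
      then show ?thesis using True sq by (simp add: d_def)
    next
      case False
      have "0 \<le> - c e * (d \<bullet> d)" using R2(2)[of d] d by simp
      then have "d \<bullet> d \<le> 0" using False c by (simp add: mult_le_0_iff)
      then show ?thesis by (metis inner_eq_zero_iff inner_ge_zero order_antisym)
    qed
    then show "R *v e = R' *v e" by (simp add: d_def E(2)[OF e])
  qed
qed

lemma msqrt_eqI: "pos_semidef R \<Longrightarrow> R ** R = S \<Longrightarrow> msqrt S = R"
  unfolding msqrt_def by (rule the_equality) (simp, elim conjE, rule pos_semidef_sqrt_unique, simp_all)

lemma
  assumes "pos_semidef S"
  shows pos_semidef_msqrt: "pos_semidef (msqrt S)" and msqrt_square: "msqrt S ** msqrt S = S"
proof -
  obtain R where R: "pos_semidef R" "R ** R = S" using pos_semidef_sqrt_exists[OF assms] by blast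
  then show "pos_semidef (msqrt S)" "msqrt S ** msqrt S = S" by (simp_all add: msqrt_eqI[OF R])
qed

section \<open>Positive definite matrices\<close>

lemma pos_def_imp_pos_semidef: "pos_def S \<Longrightarrow> pos_semidef S"
  unfolding pos_def_def pos_semidef_def
  by (intro conjI allI; elim conjE) (assumption, rename_tac x, case_tac "x = 0", auto intro: less_imp_le)

lemma pos_def_imp_invertible: "pos_def S \<Longrightarrow> invertible S"
  unfolding pos_def_def by (rule invertible_if_ker_trivial) fastforce

text \<open>Each eigenvalue \<open>c\<close> of \<open>R\<close> satisfies \<open>c \<ge> 0\<close>
  and \<open>c^2 > 1/4\<close>, so \<open>c > 1/2\<close>; in the eigenbasis the quadratic form is
  the sum of the eigenvalues weighted by squared coordinates, of which one is nonzero.\<close>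

lemma pos_semidef_square_gt_quarter:
  assumes R: "pos_semidef R" and N: "pos_def (R ** R - (1/4) *\<^sub>R mat 1)" and u: "u \<noteq> 0"
  shows "1/2 * (u \<bullet> u) < u \<bullet> (R *v u)"
proof -
  have R1: "transpose R = R" "\<And>x. 0 \<le> x \<bullet> (R *v x)" using R by (auto simp: pos_semidef_def)
  obtain E c where E: "finite E" "pairwise orthogonal E" "\<And>e. e \<in> E \<Longrightarrow> norm e = 1"
    "\<And>e. e \<in> E \<Longrightarrow> R *v e = c e *\<^sub>R e" "span E = UNIV"
    using symmetric_orthonormal_eigenbasis[OF R1(1)] by blast
  have c: "c e > 1/2" if e: "e \<in> E" for e
  proof -
    have "e \<noteq> 0" using E(3)[OF e] by auto
    then have "0 < e \<bullet> ((R ** R - (1/4) *\<^sub>R mat 1) *v e)" using N by (simp add: pos_def_def)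
    also have "\<dots> = (c e)\<^sup>2 - 1/4"
      using E(3,4)[OF e] by (simp add: mat_vec.diff_left mat_vec.scaleR_left mat_vec.scaleR_right inner_diff_right
          dot_square_norm power2_eq_square flip: matrix_vector_mul_assoc)
    finally have "(1/2)\<^sup>2 < (c e)\<^sup>2" by (simp add: power2_eq_square)
    moreover have "c e \<ge> 0" using R1(2)[of e] E(3,4)[OF e] by (simp add: dot_square_norm)
    ultimately show ?thesis by (rule power_less_imp_less_base)
  qed
  have exp: "(\<Sum>e\<in>E. (u \<bullet> e) *\<^sub>R e) = u" using E by (intro orthonormal_basis_expansion)
  have uu: "u \<bullet> u = (\<Sum>e\<in>E. (u \<bullet> e)\<^sup>2)"
    by (subst (2) exp [symmetric]) (simp add: inner_sum_right power2_eq_square)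
  have "R *v u = (\<Sum>e\<in>E. (u \<bullet> e) *\<^sub>R (R *v e))"
    by (subst exp [symmetric]) (simp add: mat_vec.sum_right mat_vec.scaleR_right)
  then have "u \<bullet> (R *v u) = (\<Sum>e\<in>E. c e * (u \<bullet> e)\<^sup>2)"
    by (simp add: inner_sum_right E(4) power2_eq_square mult_ac)
  moreover have "(\<Sum>e\<in>E. 1/2 * (u \<bullet> e)\<^sup>2) < (\<Sum>e\<in>E. c e * (u \<bullet> e)\<^sup>2)"
  proof (rule sum_strict_mono_ex1[OF E(1)])
    show "\<forall>e\<in>E. 1/2 * (u \<bullet> e)\<^sup>2 \<le> c e * (u \<bullet> e)\<^sup>2"
    proof
      fix e assume "e \<in> E"
      then show "1/2 * (u \<bullet> e)\<^sup>2 \<le> c e * (u \<bullet> e)\<^sup>2"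
        by (intro mult_right_mono less_imp_le[OF c]) auto
    qed
    have "\<exists>e\<in>E. u \<bullet> e \<noteq> 0"
    proof (rule ccontr)
      assume "\<not> (\<exists>e\<in>E. u \<bullet> e \<noteq> 0)"
      then have "u \<bullet> u = 0" by (simp add: uu)
      with u show False by simp
    qed
    then obtain e where e: "e \<in> E" "u \<bullet> e \<noteq> 0" by blast
    then have "1/2 * (u \<bullet> e)\<^sup>2 < c e * (u \<bullet> e)\<^sup>2"
      by (intro mult_strict_right_mono c) auto
    with e show "\<exists>e\<in>E. 1/2 * (u \<bullet> e)\<^sup>2 < c e * (u \<bullet> e)\<^sup>2" by blast
  qed
  ultimately show ?thesis by (simp add: uu sum_distrib_left)
qed

lemma pos_def_congruence:
  fixes M S :: "real^'n^'n"
  assumes S: "pos_def S" and M: "invertible M"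
  shows "pos_def (M ** S ** transpose M)"
  unfolding pos_def_def
proof (intro conjI allI impI)
  show "transpose (M ** S ** transpose M) = M ** S ** transpose M"
    using S by (simp add: matrix_transpose_mul pos_def_def matrix_mul_assoc)
  fix x :: "real^'n" assume "x \<noteq> 0"
  then have "transpose M *v x \<noteq> 0"
    using invertible_mult_vector_eq_0[OF transpose_invertible[OF M]] by blast
  then have "0 < (transpose M *v x) \<bullet> (S *v (transpose M *v x))"
    using S by (simp add: pos_def_def)
  then show "0 < x \<bullet> (M ** S ** transpose M *v x)"
    by (simp add: inner_matrix_vector[of x M] flip: matrix_vector_mul_assoc)
qed

text \<open>The inverse is the congruence of \<open>S\<close> by its own inverse.\<close>

lemma pos_def_matrix_inv:
  assumes S: "pos_def S"
  shows "pos_def (matrix_inv S)"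
proof -
  have inv: "invertible S" using S by (rule pos_def_imp_invertible)
  have sym: "transpose (matrix_inv S) = matrix_inv S"
    using S matrix_inv_transpose[OF inv] by (simp add: pos_def_def)
  have "pos_def (matrix_inv S ** S ** transpose (matrix_inv S))"
    using S invertible_matrix_inv[OF inv] by (rule pos_def_congruence)
  then show ?thesis using inv by (simp add: sym)
qed

lemma transpose_diff: "transpose (A - B) = transpose A - transpose B" for A B :: "real^'n^'m"
  by (simp add: transpose_def vec_eq_iff)

lemma transpose_add: "transpose (A + B) = transpose A + transpose B" for A B :: "real^'n^'m"
  by (simp add: transpose_def vec_eq_iff)

lemma transpose_uminus: "transpose (- A) = - transpose A" for A :: "real^'n^'m"
  by (simp add: transpose_def vec_eq_iff)

lemma pos_def_add: "pos_def A \<Longrightarrow> pos_def B \<Longrightarrow> pos_def (A + B)"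
  by (simp add: pos_def_def transpose_add mat_vec.add_left inner_add_right add_pos_pos)

lemma matrix_eqI_inner:
  fixes A B :: "real^'n^'m"
  assumes "\<And>v w. v \<bullet> (A *v w) = v \<bullet> (B *v w)"
  shows "A = B"
proof -
  have "A *v w = B *v w" for w using assms vector_eq_ldot by blast
  then show ?thesis by (simp only: matrix_eq) blast
qed

section \<open>The quadratic matrix equation\<close>

text \<open>The equation at hand is \<open>Z ** \<Sigma> ** Z - Z = C\<close>. Congruence with the
  root of \<open>\<Sigma>\<close> replaces it by
  \<open>W ** W - W = \<sigma> ** C ** \<sigma>\<close> for
  \<open>W = \<sigma> ** Z ** \<sigma>\<close>, where the square can be completed.\<close>

locale quadratic_matrix_equation =
  fixes \<Sigma> C :: "real^'n^'n"
  assumes \<Sigma>: "pos_def \<Sigma>" and C: "pos_def C"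
begin

abbreviation "\<sigma> \<equiv> msqrt \<Sigma>"

abbreviation "\<rho> \<equiv> msqrt ((1/4) *\<^sub>R mat 1 + \<sigma> ** C ** \<sigma>)"

lemma \<sigma>_square: "\<sigma> ** \<sigma> = \<Sigma>" and \<sigma>_psd: "pos_semidef \<sigma>"
  using pos_def_imp_pos_semidef[OF \<Sigma>] by (auto intro: msqrt_square pos_semidef_msqrt)

lemma \<sigma>_sym: "transpose \<sigma> = \<sigma>"
  using \<sigma>_psd by (simp add: pos_semidef_def)

lemma \<sigma>_inv: "invertible \<sigma>"
proof -
  have "\<sigma> ** (\<sigma> ** matrix_inv \<Sigma>) = mat 1"
    using pos_def_imp_invertible[OF \<Sigma>] by (simp add: matrix_mul_assoc \<sigma>_square)
  then show ?thesis by (auto simp: invertible_right_inverse)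
qed

lemma cancel [simp]:
  "M ** \<sigma> ** matrix_inv \<sigma> = M" "M ** matrix_inv \<sigma> ** \<sigma> = M" "M ** \<sigma> ** \<sigma> = M ** \<Sigma>"
  for M :: "real^'n^'m"
  using \<sigma>_inv by (simp_all add: \<sigma>_square flip: matrix_mul_assoc)

lemma inv_\<Sigma>: "matrix_inv \<Sigma> = matrix_inv \<sigma> ** matrix_inv \<sigma>"
proof (rule matrix_inv_unique)
  have "\<sigma> ** \<sigma> ** (matrix_inv \<sigma> ** matrix_inv \<sigma>) = mat 1"
    by (simp add: matrix_mul_assoc \<sigma>_inv)
  then show "\<Sigma> ** (matrix_inv \<sigma> ** matrix_inv \<sigma>) = mat 1" by (simp only: \<sigma>_square)
qed

lemma pos_def_\<sigma>C\<sigma>: "pos_def (\<sigma> ** C ** \<sigma>)"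
  using pos_def_congruence[OF C \<sigma>_inv] by (simp add: \<sigma>_sym)

lemma \<rho>: "pos_semidef \<rho>" "\<rho> ** \<rho> = (1/4) *\<^sub>R mat 1 + \<sigma> ** C ** \<sigma>"
proof -
  have "pos_def ((1/4) *\<^sub>R mat 1 :: real^'n^'n)"
    by (simp add: pos_def_def transpose_scalar mat_vec.scaleR_left)
  then have "pos_semidef ((1/4) *\<^sub>R mat 1 + \<sigma> ** C ** \<sigma>)"
    by (intro pos_def_imp_pos_semidef pos_def_add pos_def_\<sigma>C\<sigma>)
  then show "pos_semidef \<rho>" "\<rho> ** \<rho> = (1/4) *\<^sub>R mat 1 + \<sigma> ** C ** \<sigma>"
    by (auto intro: msqrt_square pos_semidef_msqrt)
qed

text \<open>Completing the square shows that \<open>I/2 - W\<close> is some symmetric root; the sign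
  of \<open>Z\<close> makes it positive semidefinite, and uniqueness of that root identifies it with
  \<open>\<rho>\<close>.\<close>

lemma nonpos_root_eq:
  assumes eq: "Z ** \<Sigma> ** Z - Z = C" and sym: "transpose Z = Z" and nonpos: "\<And>v. v \<bullet> (Z *v v) \<le> 0"
  shows "Z = (1/2) *\<^sub>R matrix_inv \<Sigma> - matrix_inv \<sigma> ** \<rho> ** matrix_inv \<sigma>"
proof -
  define R where "R = (1/2) *\<^sub>R mat 1 - \<sigma> ** Z ** \<sigma>"
  have "transpose R = R"
    by (simp add: R_def transpose_diff transpose_scalar matrix_transpose_mul \<sigma>_sym sym matrix_mul_assoc)
  moreover have "0 \<le> v \<bullet> (R *v v)" for v
    using nonpos[of "\<sigma> *v v"]
    by (simp add: R_def mat_vec.diff_left mat_vec.scaleR_left inner_diff_right inner_symmetric_matrix[OF \<sigma>_sym, of v]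
        flip: matrix_vector_mul_assoc) (use inner_ge_zero[of v] in linarith)
  ultimately have "pos_semidef R" by (simp add: pos_semidef_def)
  moreover have "R ** R = (1/4) *\<^sub>R mat 1 + \<sigma> ** C ** \<sigma>"
    by (simp add: R_def eq [symmetric] mat_mult.diff_left mat_mult.diff_right mat_mult.scaleR_left mat_mult.scaleR_right matrix_mul_assoc
        vec_eq_iff diff_divide_distrib add_divide_distrib)
  ultimately have "\<rho> = R" by (rule msqrt_eqI)
  then show ?thesis
    by (simp add: R_def inv_\<Sigma> mat_mult.diff_left mat_mult.diff_right mat_mult.scaleR_left mat_mult.scaleR_right matrix_mul_assoc \<sigma>_inv)
qed

context
  fixes Z assumes Z: "Z = (1/2) *\<^sub>R matrix_inv \<Sigma> - matrix_inv \<sigma> ** \<rho> ** matrix_inv \<sigma>"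
begin

lemma \<sigma>_root: "\<sigma> ** Z ** \<sigma> = (1/2) *\<^sub>R mat 1 - \<rho>"
  by (simp add: Z inv_\<Sigma> mat_mult.diff_left mat_mult.diff_right mat_mult.scaleR_left mat_mult.scaleR_right matrix_mul_assoc \<sigma>_inv)

lemma root_symmetric: "transpose Z = Z"
proof -
  have "transpose \<rho> = \<rho>" using \<rho>(1) by (simp add: pos_semidef_def)
  then show ?thesis
    by (simp add: Z inv_\<Sigma> transpose_diff transpose_scalar matrix_transpose_mul \<sigma>_sym matrix_mul_assoc
        flip: matrix_inv_transpose[OF \<sigma>_inv])
qed

text \<open>With \<open>W = I/2 - \<rho>\<close> one has
  \<open>W ** W - W = \<rho> ** \<rho> - I/4\<close>; the congruence with \<open>\<sigma>\<close> is
  then undone.\<close>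

lemma root_equation: "Z ** \<Sigma> ** Z - Z = C"
proof -
  let ?W = "\<sigma> ** Z ** \<sigma>"
  have "?W ** ?W - ?W = \<sigma> ** C ** \<sigma>"
    unfolding \<sigma>_root
    by (simp add: mat_mult.diff_left mat_mult.diff_right mat_mult.scaleR_left mat_mult.scaleR_right \<rho>(2) vec_eq_iff diff_divide_distrib add_divide_distrib)
  then have "matrix_inv \<sigma> ** (?W ** ?W - ?W) ** matrix_inv \<sigma> = matrix_inv \<sigma> ** (\<sigma> ** C ** \<sigma>) ** matrix_inv \<sigma>"
    by simp
  then show ?thesis
    using \<sigma>_inv by (simp add: mat_mult.diff_left mat_mult.diff_right matrix_mul_assoc)
qed

text \<open>Since \<open>\<sigma> ** C ** \<sigma>\<close> is positive definite,
  \<open>\<rho>\<close> exceeds \<open>I/2\<close> strictly, so \<open>I/2 - \<rho>\<close> and its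
  congruent \<open>Z\<close> are negative definite.\<close>

lemma root_neg_def: "v \<noteq> 0 \<Longrightarrow> v \<bullet> (Z *v v) < 0"
proof -
  assume v: "v \<noteq> 0"
  define u where "u = matrix_inv \<sigma> *v v"
  have vu: "v = \<sigma> *v u" using \<sigma>_inv by (simp add: u_def matrix_vector_mul_assoc)
  then have "u \<noteq> 0" using v by auto
  then have "1/2 * (u \<bullet> u) < u \<bullet> (\<rho> *v u)"
    using \<rho> pos_def_\<sigma>C\<sigma> by (intro pos_semidef_square_gt_quarter) auto
  moreover have "v \<bullet> (Z *v v) = u \<bullet> ((\<sigma> ** Z ** \<sigma>) *v u)"
    by (simp add: vu inner_symmetric_matrix[OF \<sigma>_sym, of u] flip: matrix_vector_mul_assoc)
  ultimately show ?thesis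
    by (simp add: \<sigma>_root mat_vec.diff_left mat_vec.scaleR_left inner_diff_right)
qed

end

end

text \<open>Here \<open>F\<close> stands for \<open>F12\<close>, \<open>D\<close> for the sum of the
  Riccati pair at time \<open>T\<close>, and \<open>eq\<close> for the invariance of the symplectic
  form. It makes \<open>transpose F ** D ** F\<close> the inverse of
  \<open>Z ** \<Sigma> ** Z - Z\<close>, so prescribing \<open>D\<close> prescribes this quadratic
  expression.\<close>

lemma terminal_covariance_iff:
  fixes Z \<Sigma> \<Sigma>' F D :: "real^'n^'n"
  assumes \<Sigma>: "invertible \<Sigma>" and \<Sigma>': "invertible \<Sigma>'" and F: "invertible F"
    and eq: "Z ** (transpose F ** D ** F) ** (Z - matrix_inv \<Sigma>) = matrix_inv \<Sigma>"
  shows "matrix_inv \<Sigma>' = D \<longleftrightarrow>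
    Z ** \<Sigma> ** Z - Z = matrix_inv F ** \<Sigma>' ** matrix_inv (transpose F)"
proof -
  let ?E = "transpose F ** D ** F" and ?C = "matrix_inv F ** \<Sigma>' ** matrix_inv (transpose F)"
  have F': "invertible (transpose F)" using F by (rule transpose_invertible)
  have "Z ** (?E ** (Z - matrix_inv \<Sigma>) ** \<Sigma>) = mat 1"
    using \<Sigma> by (simp add: matrix_mul_assoc eq[unfolded matrix_mul_assoc])
  \<comment> \<open>\<open>Z\<close> moves from the left end to the right end, as left and right
    inverses of square matrices agree.\<close>
  then have "?E ** (Z - matrix_inv \<Sigma>) ** \<Sigma> ** Z = mat 1"
    by (simp add: matrix_left_right_inverse)
  moreover have "(Z - matrix_inv \<Sigma>) ** \<Sigma> ** Z = Z ** \<Sigma> ** Z - Z"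
    using \<Sigma> by (simp add: mat_mult.diff_left)
  ultimately have E: "?E ** (Z ** \<Sigma> ** Z - Z) = mat 1"
    by (metis matrix_mul_assoc)
  show ?thesis
  proof
    assume D: "matrix_inv \<Sigma>' = D"
    have "?E ** ?C = transpose F ** D ** (F ** matrix_inv F) ** \<Sigma>' ** matrix_inv (transpose F)"
      by (simp only: matrix_mul_assoc)
    also have "\<dots> = transpose F ** (D ** \<Sigma>') ** matrix_inv (transpose F)"
      using F by (simp add: matrix_mul_assoc)
    also have "\<dots> = mat 1" using F' \<Sigma>' by (simp flip: D)
    finally have "?E ** ?C = mat 1" .
    with E show "Z ** \<Sigma> ** Z - Z = ?C" by (metis matrix_inv_unique)
  next
    assume C: "Z ** \<Sigma> ** Z - Z = ?C"
    have "matrix_inv (transpose F) ** (?E ** ?C) ** transpose F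
        = (matrix_inv (transpose F) ** transpose F) ** D ** (F ** matrix_inv F) ** \<Sigma>' ** (matrix_inv (transpose F) ** transpose F)"
      by (simp only: matrix_mul_assoc)
    then have "D ** \<Sigma>' = mat 1" using E F F' by (simp add: C)
    then show "matrix_inv \<Sigma>' = D"
      by (intro matrix_inv_unique) (simp add: matrix_left_right_inverse)
  qed
qed

section \<open>Linear Hamiltonian systems\<close>

lemma inner_matrix_vector_left: "(A *v x) \<bullet> y = x \<bullet> (transpose A *v y)" for A :: "real^'n^'m"
  by (rule inner_transpose [symmetric])

text \<open>The entry type is left open: with real entries this is the state part of a vector, with
  rows as entries the upper block of a matrix. The same holds for \<open>lower\<close> and
  \<open>stack\<close>.\<close>

definition upper :: "'a^('n + 'n) \<Rightarrow> 'a^'n" where "upper z = (\<chi> i. z $ Inl i)"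

definition lower :: "'a^('n + 'n) \<Rightarrow> 'a^'n" where "lower z = (\<chi> i. z $ Inr i)"

definition stack :: "'a^'n \<Rightarrow> 'a^'n \<Rightarrow> 'a^('n + 'n)" where
  "stack x y = (\<chi> i. case i of Inl k \<Rightarrow> x $ k | Inr k \<Rightarrow> y $ k)"

lemma upper_stack [simp]: "upper (stack x y) = x" and lower_stack [simp]: "lower (stack x y) = y"
  by (simp_all add: upper_def lower_def stack_def vec_eq_iff)

lemma stack_eqI: "upper z = upper w \<Longrightarrow> lower z = lower w \<Longrightarrow> z = w"
  unfolding upper_def lower_def vec_eq_iff by simp (metis old.sum.exhaust)

lemma upper_zero [simp]: "upper 0 = 0" and lower_zero [simp]: "lower 0 = 0"
  and upper_diff: "upper (z - w) = upper z - upper w"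
  and lower_diff: "lower (z - w) = lower z - lower w"
  by (simp_all add: upper_def lower_def vec_eq_iff)

lemma bounded_linear_upper: "bounded_linear (upper :: 'a::euclidean_space^('n + 'n) \<Rightarrow> 'a^'n)"
  unfolding linear_conv_bounded_linear [symmetric]
  by (auto intro!: linearI simp: upper_def vec_eq_iff)

lemma bounded_linear_lower: "bounded_linear (lower :: 'a::euclidean_space^('n + 'n) \<Rightarrow> 'a^'n)"
  unfolding linear_conv_bounded_linear [symmetric]
  by (auto intro!: linearI simp: lower_def vec_eq_iff)

lemma stack_matrix_vector: "stack M N *v v = stack (M *v v) (N *v v)"
  by (rule stack_eqI) (simp_all add: upper_def lower_def stack_def vec_eq_iff matrix_vector_mult_def)

lemma sum_UNIV_Plus: "sum f (UNIV :: ('a::finite + 'b::finite) set) = (\<Sum>i\<in>UNIV. f (Inl i)) + (\<Sum>i\<in>UNIV. f (Inr i))"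
  unfolding UNIV_Plus_UNIV [symmetric] by (subst sum.Plus) auto

lemma upper_matrix_vector_mult: "upper (N *v v) = upper N *v v"
  by (simp add: upper_def vec_eq_iff matrix_vector_mult_def)

lemma upper_block_matrix_vector: "upper (block_matrix a b c d *v z) = a *v upper z + b *v lower z"
  and lower_block_matrix_vector: "lower (block_matrix a b c d *v z) = c *v upper z + d *v lower z"
  by (simp_all add: upper_def lower_def vec_eq_iff block_matrix_def matrix_vector_mult_def sum_UNIV_Plus)

lemma upper_block_matrix_mult: "upper (block_matrix a b c d ** N) = a ** upper N + b ** lower N"
  and lower_block_matrix_mult: "lower (block_matrix a b c d ** N) = c ** upper N + d ** lower N"
  by (simp_all add: upper_def lower_def vec_eq_iff block_matrix_def matrix_matrix_mult_def sum_UNIV_Plus)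

lemma upper_mult_stack: "upper (M *v stack x y) = block11 M *v x + block12 M *v y"
  by (simp add: upper_def vec_eq_iff stack_def block11_def block12_def matrix_vector_mult_def sum_UNIV_Plus)

definition symp :: "real^('n::finite + 'n) \<Rightarrow> real^('n + 'n) \<Rightarrow> real" where
  "symp z w = upper z \<bullet> lower w - lower z \<bullet> upper w"

text \<open>Tested against \<open>(- l, x)\<close>, the form at \<open>(x, l)\<close> is the squared
  norm of \<open>(x, l)\<close>.\<close>

lemma symp_nondegenerate:
  assumes "\<And>w. symp z w = 0"
  shows "z = 0"
proof -
  have "symp z (stack (- lower z) (upper z)) = 0" by (rule assms)
  then have *: "upper z \<bullet> upper z + lower z \<bullet> lower z = 0" by (simp add: symp_def)
  then have "upper z = 0 \<and> lower z = 0"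
    by (metis add_nonneg_eq_0_iff inner_eq_zero_iff inner_ge_zero)
  then show ?thesis by (intro stack_eqI) auto
qed

section \<open>Monotonicity from derivatives and uniqueness for linear equations\<close>

lemma nonincreasing_if_derivative_nonpos:
  fixes f :: "real \<Rightarrow> real"
  assumes "\<And>t. t \<in> {a..b} \<Longrightarrow> (f has_vector_derivative f' t) (at t within {a..b})"
    and "\<And>t. t \<in> {a..b} \<Longrightarrow> f' t \<le> 0" and "a \<le> s" "s \<le> t" "t \<le> b"
  shows "f t \<le> f s"
proof (cases "s < t")
  case True
  have "\<exists>x\<in>{s<..<t}. f t - f s = (\<lambda>h. h *\<^sub>R f' x) (t - s)"
  proof (rule mvt_simple[OF True])
    fix x assume "s \<le> x" "x \<le> t"
    then show "(f has_derivative (\<lambda>h. h *\<^sub>R f' x)) (at x within {s..t})"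
      using assms unfolding has_vector_derivative_def
      by (intro has_derivative_subset[of f _ x "{a..b}" "{s..t}"]) auto
  qed
  then obtain x where x: "x \<in> {s<..<t}" "f t - f s = (t - s) * f' x" by auto
  moreover have "(t - s) * f' x \<le> 0"
    using x assms True by (intro mult_nonneg_nonpos) auto
  ultimately show ?thesis by linarith
qed (use assms in auto)

lemma constant_if_derivative_zero:
  fixes f :: "real \<Rightarrow> real"
  assumes "\<And>t. t \<in> {a..b} \<Longrightarrow> (f has_vector_derivative 0) (at t within {a..b})" and t: "t \<in> {a..b}"
  shows "f t = f a"
proof (rule antisym)
  show "f t \<le> f a"
    using t by (intro nonincreasing_if_derivative_nonpos[OF assms(1)]) auto
  have "((\<lambda>t. - f t) has_vector_derivative 0) (at t within {a..b})" if "t \<in> {a..b}" for t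
    using assms(1)[OF that] by (auto intro: derivative_eq_intros)
  then have "- f t \<le> - f a"
    using t by (intro nonincreasing_if_derivative_nonpos[where f = "\<lambda>t. - f t" and f' = "\<lambda>_. 0"]) auto
  then show "f a \<le> f t" by simp
qed

text \<open>Gronwall's argument: with \<open>C\<close> bounding the growth rate on the compact
  interval, \<open>exp (- 2 * C * t)\<close> times the squared norm is nonincreasing, and it starts
  at 0.\<close>

lemma linear_ode_zero:
  fixes d :: "real \<Rightarrow> real^'n" and L :: "real \<Rightarrow> real^'n^'n"
  assumes d: "\<And>t. t \<in> {a..b} \<Longrightarrow> (d has_vector_derivative L t *v d t) (at t within {a..b})"
    and L: "continuous_on {a..b} L" and 0: "d a = 0" and t: "t \<in> {a..b}"
  shows "d t = 0"
proof -
  obtain K where K: "K > 0" "\<And>(m::real^'n^'n) (x::real^'n). norm (m *v x) \<le> norm m * norm x * K"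
    using mat_vec.pos_bounded by blast
  have "compact (L ` {a..b})" using L by (intro compact_continuous_image) auto
  then obtain C0 where C0: "\<And>t. t \<in> {a..b} \<Longrightarrow> norm (L t) \<le> C0"
    by (metis bounded_iff compact_imp_bounded image_eqI)
  define C where "C = C0 * K"
  have C: "d s \<bullet> (L s *v d s) \<le> C * (d s \<bullet> d s)" if s: "s \<in> {a..b}" for s
  proof -
    have "d s \<bullet> (L s *v d s) \<le> norm (d s) * norm (L s *v d s)" by (rule norm_cauchy_schwarz)
    also have "\<dots> \<le> norm (d s) * (norm (L s) * norm (d s) * K)"
      by (intro mult_left_mono K) auto
    also have "\<dots> \<le> norm (d s) * (C0 * norm (d s) * K)"
      using K C0[OF s] by (intro mult_left_mono mult_right_mono) auto
    finally show ?thesis by (simp add: C_def dot_square_norm power2_eq_square mult_ac)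
  qed
  let ?g = "\<lambda>s. exp (- 2 * C * s) * (d s \<bullet> d s)"
  have g: "(?g has_vector_derivative exp (- 2 * C * s) * (d s \<bullet> (L s *v d s) + (L s *v d s) \<bullet> d s)
      + - 2 * C * exp (- 2 * C * s) * (d s \<bullet> d s)) (at s within {a..b})" if s: "s \<in> {a..b}" for s
  proof (rule has_vector_derivative_mult)
    show "((\<lambda>s. exp (- 2 * C * s)) has_vector_derivative - 2 * C * exp (- 2 * C * s)) (at s within {a..b})"
      unfolding has_real_derivative_iff_has_vector_derivative [symmetric]
      by (auto intro!: derivative_eq_intros)
    show "((\<lambda>s. d s \<bullet> d s) has_vector_derivative d s \<bullet> (L s *v d s) + (L s *v d s) \<bullet> d s) (at s within {a..b})"
      by (rule bounded_bilinear.has_vector_derivative[OF bounded_bilinear_inner d[OF s] d[OF s]])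
  qed
  have "?g t \<le> ?g a"
  proof (rule nonincreasing_if_derivative_nonpos[OF g])
    fix s assume s: "s \<in> {a..b}"
    have "exp (- 2 * C * s) * (2 * (d s \<bullet> (L s *v d s) - C * (d s \<bullet> d s))) \<le> 0"
      using C[OF s] by (intro mult_nonneg_nonpos) auto
    then show "exp (- 2 * C * s) * (d s \<bullet> (L s *v d s) + (L s *v d s) \<bullet> d s)
      + - 2 * C * exp (- 2 * C * s) * (d s \<bullet> d s) \<le> 0"
      by (simp add: inner_commute[of "L s *v d s"] algebra_simps)
  qed (use t in auto)
  then have "exp (- 2 * C * t) * (d t \<bullet> d t) \<le> 0" by (simp add: 0)
  then have "d t \<bullet> d t \<le> 0" by (simp add: mult_le_0_iff)
  then show ?thesis by (metis inner_eq_zero_iff inner_ge_zero order_antisym)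
qed

section \<open>One mode: its Hamiltonian flow and its Riccati solutions\<close>

locale hamiltonian_mode =
  fixes a b :: real and A :: "real \<Rightarrow> real^'n^'n" and B :: "real \<Rightarrow> real^'m^'n"
    and Q :: "real \<Rightarrow> real^'n^'n" and \<Phi> :: "real \<Rightarrow> real \<Rightarrow> real^('n + 'n)^('n + 'n)"
  assumes ab: "a < b" and contA: "continuous_on {a..b} A" and contB: "continuous_on {a..b} B"
    and symQ: "t \<in> {a..b} \<Longrightarrow> transpose (Q t) = Q t"
    and kernel: "transition_kernel {a..b} (hamiltonian_matrix A B Q) \<Phi>"
begin

definition trajectory :: "(real \<Rightarrow> real^('n + 'n)) \<Rightarrow> bool" where
  "trajectory z \<longleftrightarrow>
     (\<forall>t\<in>{a..b}. (z has_vector_derivative hamiltonian_matrix A B Q t *v z t) (at t within {a..b}))"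

definition riccati :: "(real \<Rightarrow> real^'n^'n) \<Rightarrow> bool" where
  "riccati P \<longleftrightarrow> (\<forall>t\<in>{a..b}. (P has_vector_derivative
     - (transpose (A t) ** P t + P t ** A t - P t ** B t ** transpose (B t) ** P t + Q t)) (at t within {a..b}))"

lemma riccati_pair_on_iff: "riccati_pair_on {a..b} A B Q P H \<longleftrightarrow> riccati P \<and> riccati (\<lambda>t. - H t)"
proof -
  have "(H has_vector_derivative - (transpose (A t) ** H t + H t ** A t
        + H t ** B t ** transpose (B t) ** H t - Q t)) (at t within {a..b}) \<longleftrightarrow>
      ((\<lambda>t. - H t) has_vector_derivative - (transpose (A t) ** - H t + - H t ** A t
        - - H t ** B t ** transpose (B t) ** - H t + Q t)) (at t within {a..b})" (is "?l \<longleftrightarrow> ?r") for t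
  proof
    assume ?l
    then show ?r
      by (rule has_vector_derivative_eq_rhs[OF has_vector_derivative_minus])
        (simp add: mat_mult.minus_left mat_mult.minus_right)
  next
    assume ?r
    from has_vector_derivative_minus[OF this] show ?l
      by (simp add: mat_mult.minus_left mat_mult.minus_right algebra_simps)
  qed
  then show ?thesis by (auto simp: riccati_pair_on_def riccati_def)
qed

definition flow :: "real^('n + 'n) \<Rightarrow> real \<Rightarrow> real^('n + 'n)" where
  "flow z t = \<Phi> t a *v z"

lemma flow_start [simp]: "flow z a = z"
  using kernel ab by (simp add: flow_def transition_kernel_def)

lemma kernel_derivative:
  "t \<in> {a..b} \<Longrightarrow> ((\<lambda>t. \<Phi> t a) has_vector_derivative hamiltonian_matrix A B Q t ** \<Phi> t a) (at t within {a..b})"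
  using kernel ab by (simp add: transition_kernel_def)

lemma trajectory_flow: "trajectory (flow z)"
  unfolding trajectory_def flow_def
  using bounded_linear.has_vector_derivative[OF mat_vec.bounded_linear_left kernel_derivative]
  by (simp add: matrix_vector_mul_assoc)

lemma flow_diff: "flow (z - w) t = flow z t - flow w t"
  by (simp add: flow_def mat_vec.diff_right)

lemma upper_derivative:
  assumes "trajectory z" "t \<in> {a..b}"
  shows "((\<lambda>t. upper (z t)) has_vector_derivative
      A t *v upper (z t) - B t *v (transpose (B t) *v lower (z t))) (at t within {a..b})"
proof -
  have "(z has_vector_derivative hamiltonian_matrix A B Q t *v z t) (at t within {a..b})"
    using assms by (simp add: trajectory_def)
  from bounded_linear.has_vector_derivative[OF bounded_linear_upper this] show ?thesis
    by (simp add: hamiltonian_matrix_def upper_block_matrix_vector mat_vec.minus_left matrix_vector_mul_assoc)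
qed

lemma lower_derivative:
  assumes "trajectory z" "t \<in> {a..b}"
  shows "((\<lambda>t. lower (z t)) has_vector_derivative
      - (Q t *v upper (z t)) - transpose (A t) *v lower (z t)) (at t within {a..b})"
proof -
  have "(z has_vector_derivative hamiltonian_matrix A B Q t *v z t) (at t within {a..b})"
    using assms by (simp add: trajectory_def)
  from bounded_linear.has_vector_derivative[OF bounded_linear_lower this] show ?thesis
    by (simp add: hamiltonian_matrix_def lower_block_matrix_vector mat_vec.minus_left)
qed

text \<open>In the derivative of the form the \<open>A\<close> terms cancel by adjointness, the
  \<open>B\<close> and \<open>Q\<close> terms by symmetry of \<open>B B'\<close> and
  \<open>Q\<close>.\<close>

lemma symp_trajectory:
  assumes z: "trajectory z" and w: "trajectory w" and t: "t \<in> {a..b}"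
  shows "symp (z t) (w t) = symp (z a) (w a)"
proof -
  have "((\<lambda>t. symp (z t) (w t)) has_vector_derivative 0) (at t within {a..b})" if t: "t \<in> {a..b}" for t
    unfolding symp_def
    by (rule has_vector_derivative_eq_rhs[OF has_vector_derivative_diff[OF
        bounded_bilinear.has_vector_derivative[OF bounded_bilinear_inner upper_derivative[OF z t] lower_derivative[OF w t]]
        bounded_bilinear.has_vector_derivative[OF bounded_bilinear_inner lower_derivative[OF z t] upper_derivative[OF w t]]]])
      (simp add: inner_diff_left inner_diff_right inner_transpose[of _ "A t"] inner_matrix_vector[of _ "B t"]
        inner_matrix_vector_left[of "B t"] inner_symmetric_matrix[OF symQ[OF t]]
        inner_matrix_vector_left[of "transpose (A t)"])
  then show ?thesis using t by (rule constant_if_derivative_zero)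
qed

text \<open>The derivative of \<open>x \<bullet> l\<close> is \<open>- (x \<bullet> Q x)\<close>
  minus the squared norm of \<open>B' l\<close>.\<close>

lemma inner_trajectory_antimono:
  assumes z: "trajectory z" and Q: "\<And>t. t \<in> {a..b} \<Longrightarrow> pos_semidef (Q t)" and "a \<le> s" "s \<le> t" "t \<le> b"
  shows "upper (z t) \<bullet> lower (z t) \<le> upper (z s) \<bullet> lower (z s)"
proof (rule nonincreasing_if_derivative_nonpos[where f = "\<lambda>t. upper (z t) \<bullet> lower (z t)" and f' = "\<lambda>t. - (upper (z t) \<bullet> (Q t *v upper (z t)))
      - (transpose (B t) *v lower (z t)) \<bullet> (transpose (B t) *v lower (z t))"])
  fix t assume t: "t \<in> {a..b}"
  show "((\<lambda>t. upper (z t) \<bullet> lower (z t)) has_vector_derivative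
      - (upper (z t) \<bullet> (Q t *v upper (z t)))
      - (transpose (B t) *v lower (z t)) \<bullet> (transpose (B t) *v lower (z t))) (at t within {a..b})"
    by (rule has_vector_derivative_eq_rhs[OF
        bounded_bilinear.has_vector_derivative[OF bounded_bilinear_inner upper_derivative[OF z t] lower_derivative[OF z t]]])
      (simp add: inner_diff_left inner_diff_right inner_transpose[of _ "A t"] inner_matrix_vector_left[of "B t"])
  have "0 \<le> upper (z t) \<bullet> (Q t *v upper (z t))"
    using Q[OF t] by (simp add: pos_semidef_def)
  then show "- (upper (z t) \<bullet> (Q t *v upper (z t)))
      - (transpose (B t) *v lower (z t)) \<bullet> (transpose (B t) *v lower (z t)) \<le> 0"
    using inner_ge_zero[of "transpose (B t) *v lower (z t)"] by linarith
qed (use assms in auto)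

lemma riccati_continuous: "riccati P \<Longrightarrow> continuous_on {a..b} P"
  unfolding riccati_def continuous_on_eq_continuous_within
  using has_vector_derivative_continuous by blast

text \<open>The Riccati equation is what makes the defect \<open>l - P x\<close> solve a homogeneous
  linear equation.\<close>

lemma riccati_gap_derivative:
  assumes P: "riccati P" and z: "trajectory z" and t: "t \<in> {a..b}"
  shows "((\<lambda>t. lower (z t) - P t *v upper (z t)) has_vector_derivative
      (P t ** B t ** transpose (B t) - transpose (A t)) *v (lower (z t) - P t *v upper (z t))) (at t within {a..b})"
proof -
  have P': "(P has_vector_derivative - (transpose (A t) ** P t + P t ** A t - P t ** B t ** transpose (B t) ** P t + Q t)) (at t within {a..b})"
    using P t by (simp add: riccati_def)
  show ?thesis
    by (rule has_vector_derivative_eq_rhs[OF has_vector_derivative_diff[OF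
        lower_derivative[OF z t] mat_vec.has_vector_derivative[OF P' upper_derivative[OF z t]]]])
      (simp add: mat_vec.diff_right mat_vec.diff_left mat_vec.add_left mat_vec.minus_left mat_vec.add_right
        flip: matrix_vector_mul_assoc)
qed

text \<open>The defect starts at 0 and solves a homogeneous linear equation, so it stays 0: the flow
  carries the graph of \<open>P a\<close> into the graph of \<open>P t\<close>.\<close>

lemma riccati_trajectory:
  assumes P: "riccati P" and z: "trajectory z" and init: "lower (z a) = P a *v upper (z a)" and t: "t \<in> {a..b}"
  shows "lower (z t) = P t *v upper (z t)"
proof -
  let ?d = "\<lambda>t. lower (z t) - P t *v upper (z t)"
  let ?L = "\<lambda>t. P t ** B t ** transpose (B t) - transpose (A t)"
  have "?d t = 0"
  proof (rule linear_ode_zero[OF _ _ _ t])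
    have "continuous_on {a..b} (\<lambda>t. transpose (A t))" "continuous_on {a..b} (\<lambda>t. transpose (B t))"
      using contA contB by (auto intro: bounded_linear.continuous_on[OF bounded_linear_transpose])
    then show "continuous_on {a..b} ?L"
      using contB riccati_continuous[OF P] by (intro continuous_intros mat_mult.continuous_on)
    show "?d a = 0" using init by simp
    show "(?d has_vector_derivative ?L t *v ?d t) (at t within {a..b})" if "t \<in> {a..b}" for t
      using riccati_gap_derivative[OF P z that] .
  qed
  then show ?thesis by simp
qed

text \<open>A map preserving a nondegenerate form is injective.\<close>

lemma flow_eq_0: "t \<in> {a..b} \<Longrightarrow> flow z t = 0 \<Longrightarrow> z = 0"
  by (rule symp_nondegenerate)
    (use symp_trajectory[OF trajectory_flow trajectory_flow, of t z] in \<open>auto simp: symp_def\<close>)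

text \<open>A gain is symmetric exactly when the symplectic form vanishes on its graph, and the flow
  preserves the form. The matrix \<open>?X\<close> of closed-loop states is onto, so the identity
  holds for all pairs of states at time \<open>t\<close>.\<close>

lemma riccati_symmetric:
  assumes P: "riccati P" and sym: "transpose (P a) = P a" and t: "t \<in> {a..b}"
  shows "transpose (P t) = P t"
proof -
  let ?x = "\<lambda>v. flow (stack v (P a *v v)) t"
  let ?X = "upper (\<Phi> t a ** stack (mat 1) (P a))"
  have X: "?X *v v = upper (?x v)" for v
    by (simp add: flow_def stack_matrix_vector flip: upper_matrix_vector_mult matrix_vector_mul_assoc)
  have low: "lower (?x v) = P t *v upper (?x v)" for v
    by (rule riccati_trajectory[OF P trajectory_flow _ t]) simp
  \<comment> \<open>If the state vanishes, so does its costate \<open>P t\<close> times the state,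
    and the flow is injective.\<close>
  have "invertible ?X"
  proof (rule invertible_if_ker_trivial)
    fix v assume v: "?X *v v = 0"
    then have "upper (?x v) = 0" by (simp add: X)
    moreover have "lower (?x v) = 0" using low[of v] calculation by simp
    ultimately have "stack v (P a *v v) = 0"
      using flow_eq_0[OF t] by (metis stack_eqI lower_zero upper_zero)
    then show "v = 0" by (metis upper_stack upper_zero)
  qed
  moreover have "(?X *v v) \<bullet> (P t *v (?X *v w)) = (P t *v (?X *v v)) \<bullet> (?X *v w)" for v w
    using symp_trajectory[OF trajectory_flow trajectory_flow t, of "stack v (P a *v v)" "stack w (P a *v w)"]
    by (simp add: X symp_def low inner_symmetric_matrix[OF sym])
  moreover have "?X *v (matrix_inv ?X *v v) = v" for v
    using calculation(1) by (simp add: matrix_vector_mul_assoc)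
  ultimately have "v \<bullet> (P t *v w) = (P t *v v) \<bullet> w" for v w by metis
  then have "(transpose (P t) *v v) \<bullet> w = (P t *v v) \<bullet> w" for v w
    by (metis inner_matrix_vector)
  then have "transpose (P t) *v v = P t *v v" for v
    using vector_eq_rdot by blast
  then show ?thesis by (simp only: matrix_eq) blast
qed

text \<open>Completing the square: the derivative of \<open>x \<bullet> (l - P x)\<close> is minus
  the squared norm of \<open>B' (l - P x)\<close>, in which \<open>Q\<close> has cancelled.\<close>

lemma riccati_gap_antimono:
  assumes P: "riccati P" and sym: "\<And>t. t \<in> {a..b} \<Longrightarrow> transpose (P t) = P t" and z: "trajectory z"
    and t: "t \<in> {a..b}"
  shows "upper (z t) \<bullet> (lower (z t) - P t *v upper (z t)) \<le> upper (z a) \<bullet> (lower (z a) - P a *v upper (z a))"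
proof -
  let ?x = "\<lambda>t. upper (z t)" and ?m = "\<lambda>t. lower (z t)"
  let ?f' = "\<lambda>t. - ((transpose (B t) *v (?m t - P t *v ?x t)) \<bullet> (transpose (B t) *v (?m t - P t *v ?x t)))"
  have "((\<lambda>t. ?x t \<bullet> (?m t - P t *v ?x t)) has_vector_derivative ?f' t) (at t within {a..b})"
    if t: "t \<in> {a..b}" for t
  proof -
    have "?x t \<bullet> ((P t ** B t ** transpose (B t) - transpose (A t)) *v d)
        + (A t *v ?x t - B t *v (transpose (B t) *v ?m t)) \<bullet> d
        = - ((transpose (B t) *v (?m t - P t *v ?x t)) \<bullet> (transpose (B t) *v d))" for d
      by (simp add: mat_vec.diff_left mat_vec.diff_right inner_diff_left inner_diff_right inner_transpose[of _ "A t"]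
          inner_symmetric_matrix[OF sym[OF t]] inner_matrix_vector[of _ "B t"] inner_matrix_vector_left[of "B t"]
          flip: matrix_vector_mul_assoc)
    then show ?thesis
      by (intro has_vector_derivative_eq_rhs[OF
        bounded_bilinear.has_vector_derivative[OF bounded_bilinear_inner upper_derivative[OF z t] riccati_gap_derivative[OF P z t]]])
  qed
  then show ?thesis
    by (rule nonincreasing_if_derivative_nonpos[where f = "\<lambda>t. ?x t \<bullet> (?m t - P t *v ?x t)" and f' = ?f'])
      (use t in auto)
qed

text \<open>The classical linearization: a matrix solution \<open>(X, U)\<close> of the Hamiltonian
  system gives the Riccati solution \<open>U\<close> times the inverse of \<open>X\<close>, as long
  as \<open>X\<close> stays invertible.\<close>

lemma riccati_quotient:
  fixes N :: "real^'n^('n + 'n)"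
  assumes inv: "\<And>t. t \<in> {a..b} \<Longrightarrow> invertible (upper (\<Phi> t a ** N))"
  shows "riccati (\<lambda>t. lower (\<Phi> t a ** N) ** matrix_inv (upper (\<Phi> t a ** N)))"
  unfolding riccati_def
proof
  fix t assume t: "t \<in> {a..b}"
  let ?X = "\<lambda>t. upper (\<Phi> t a ** N)" and ?U = "\<lambda>t. lower (\<Phi> t a ** N)"
  have N: "((\<lambda>t. \<Phi> t a ** N) has_vector_derivative hamiltonian_matrix A B Q t ** (\<Phi> t a ** N)) (at t within {a..b})"
    using bounded_linear.has_vector_derivative[OF mat_mult.bounded_linear_left kernel_derivative[OF t]]
    by (simp add: matrix_mul_assoc)
  have X: "(?X has_vector_derivative A t ** ?X t - B t ** transpose (B t) ** ?U t) (at t within {a..b})"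
    using bounded_linear.has_vector_derivative[OF bounded_linear_upper N]
    by (simp add: hamiltonian_matrix_def upper_block_matrix_mult mat_mult.minus_left)
  have U: "(?U has_vector_derivative - (Q t ** ?X t) - transpose (A t) ** ?U t) (at t within {a..b})"
    using bounded_linear.has_vector_derivative[OF bounded_linear_lower N]
    by (simp add: hamiltonian_matrix_def lower_block_matrix_mult mat_mult.minus_left)
  have cancel: "M ** ?X t ** matrix_inv (?X t) = M" for M :: "real^'n^'n"
    using inv[OF t] by (simp flip: matrix_mul_assoc)
  show "((\<lambda>t. ?U t ** matrix_inv (?X t)) has_vector_derivative
     - (transpose (A t) ** (?U t ** matrix_inv (?X t)) + ?U t ** matrix_inv (?X t) ** A t
       - ?U t ** matrix_inv (?X t) ** B t ** transpose (B t) ** (?U t ** matrix_inv (?X t)) + Q t)) (at t within {a..b})"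
    by (rule has_vector_derivative_eq_rhs[OF mat_mult.has_vector_derivative[OF U has_vector_derivative_matrix_inv[OF X t inv]]])
      (simp_all add: mat_mult.diff_left mat_mult.diff_right mat_mult.minus_left mat_mult.minus_right matrix_mul_assoc cancel)
qed

end

section \<open>The hybrid system\<close>

locale hybrid_system =
  m1: hamiltonian_mode 0 \<tau> A\<^sub>1 B\<^sub>1 Q\<^sub>1 \<Phi>\<^sub>1 + m2: hamiltonian_mode \<tau> T A\<^sub>2 B\<^sub>2 Q\<^sub>2 \<Phi>\<^sub>2
  for \<tau> T :: real and A\<^sub>1 A\<^sub>2 Q\<^sub>1 Q\<^sub>2 :: "real \<Rightarrow> real^'n^'n"
    and B\<^sub>1 :: "real \<Rightarrow> real^'p^'n" and B\<^sub>2 :: "real \<Rightarrow> real^'q^'n"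
    and \<Phi>\<^sub>1 \<Phi>\<^sub>2 :: "real \<Rightarrow> real \<Rightarrow> real^('n + 'n)^('n + 'n)" +
  fixes \<Xi> F11 F12 :: "real^'n^'n"
  assumes \<Xi>: "invertible \<Xi>" and F12: "invertible F12"
    and F11_def: "F11 = block11 (hybrid_transition_kernel \<tau> \<Xi> \<Phi>\<^sub>1 \<Phi>\<^sub>2 T)"
    and F12_def: "F12 = block12 (hybrid_transition_kernel \<tau> \<Xi> \<Phi>\<^sub>1 \<Phi>\<^sub>2 T)"
begin

definition jump :: "real^('n + 'n) \<Rightarrow> real^('n + 'n)" where
  "jump z = block_matrix \<Xi> 0 0 (matrix_inv (transpose \<Xi>)) *v z"

text \<open>Mode 2 is parametrized by the value at time 0, so that both modes share one initial
  datum.\<close>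

definition flow\<^sub>2 :: "real^('n + 'n) \<Rightarrow> real \<Rightarrow> real^('n + 'n)" where
  "flow\<^sub>2 z = m2.flow (jump (m1.flow z \<tau>))"

definition hybrid_riccati :: "(real \<Rightarrow> real^'n^'n) \<Rightarrow> (real \<Rightarrow> real^'n^'n) \<Rightarrow> bool" where
  "hybrid_riccati P\<^sub>1 P\<^sub>2 \<longleftrightarrow> m1.riccati P\<^sub>1 \<and> m2.riccati P\<^sub>2 \<and> jump_condition \<Xi> (P\<^sub>1 \<tau>) (P\<^sub>2 \<tau>)"

text \<open>\<open>- G\<close> is the initial gain that steers every state to 0 at time
  \<open>T\<close>; under an initial gain \<open>P\<close>, the terminal state is
  \<open>F12 ** (P + G)\<close> applied to the initial one.\<close>

abbreviation G :: "real^'n^'n" where "G \<equiv> matrix_inv F12 ** F11"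

lemma \<tau>_in: "\<tau> \<in> {0..\<tau>}" "\<tau> \<in> {\<tau>..T}" and T_in: "T \<in> {\<tau>..T}"
  using m1.ab m2.ab by auto

lemma upper_jump: "upper (jump z) = \<Xi> *v upper z"
  and lower_jump: "lower (jump z) = transpose (matrix_inv \<Xi>) *v lower z"
  by (simp_all add: jump_def upper_block_matrix_vector lower_block_matrix_vector matrix_inv_transpose[OF \<Xi>])

lemma jump_diff: "jump (z - w) = jump z - jump w"
  by (simp add: jump_def mat_vec.diff_right)

text \<open>The costate jumps by the inverse transpose of the state jump, so their pairing is kept;
  this makes the jump symplectic.\<close>

lemma inner_jump: "upper (jump z) \<bullet> lower (jump w) = upper z \<bullet> lower w"
  using \<Xi> by (simp add: upper_jump lower_jump inner_transpose matrix_vector_mul_assoc)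

lemma symp_jump: "symp (jump z) (jump w) = symp z w"
  by (simp add: symp_def inner_jump inner_commute[of "lower (jump z)"]) (simp add: inner_jump inner_commute)

lemma flow\<^sub>2_start: "flow\<^sub>2 z \<tau> = jump (m1.flow z \<tau>)"
  by (simp add: flow\<^sub>2_def)

lemma trajectory_flow\<^sub>2: "m2.trajectory (flow\<^sub>2 z)"
  by (simp add: flow\<^sub>2_def m2.trajectory_flow)

lemma flow\<^sub>2_diff: "flow\<^sub>2 (z - w) t = flow\<^sub>2 z t - flow\<^sub>2 w t"
  by (simp add: flow\<^sub>2_def m1.flow_diff jump_diff m2.flow_diff)

lemma upper_terminal: "upper (flow\<^sub>2 z T) = F11 *v upper z + F12 *v lower z"
proof -
  have "flow\<^sub>2 z T = hybrid_transition_kernel \<tau> \<Xi> \<Phi>\<^sub>1 \<Phi>\<^sub>2 T *v z"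
    using m2.ab by (simp add: flow\<^sub>2_def m1.flow_def m2.flow_def jump_def hybrid_transition_kernel_def
        matrix_vector_mul_assoc matrix_mul_assoc)
  moreover have "stack (upper z) (lower z) = z" by (rule stack_eqI) simp_all
  ultimately show ?thesis
    using upper_mult_stack[of "hybrid_transition_kernel \<tau> \<Xi> \<Phi>\<^sub>1 \<Phi>\<^sub>2 T" "upper z" "lower z"]
    by (simp add: F11_def F12_def)
qed

lemma F12_G: "F12 *v (G *v v) = F11 *v v"
  using F12 by (simp add: matrix_vector_mul_assoc matrix_mul_assoc)

lemma upper_terminal_stack: "upper (flow\<^sub>2 (stack v (P *v v)) T) = F12 *v ((P + G) *v v)"
  by (simp add: upper_terminal mat_vec.add_left mat_vec.add_right F12_G)

lemma symp_flow: "t \<in> {0..\<tau>} \<Longrightarrow> symp (m1.flow z t) (m1.flow w t) = symp z w"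
  using m1.symp_trajectory[OF m1.trajectory_flow m1.trajectory_flow] by simp

lemma symp_flow\<^sub>2: "t \<in> {\<tau>..T} \<Longrightarrow> symp (flow\<^sub>2 z t) (flow\<^sub>2 w t) = symp z w"
  using m2.symp_trajectory[OF trajectory_flow\<^sub>2 trajectory_flow\<^sub>2] \<tau>_in
  by (simp add: flow\<^sub>2_start symp_jump symp_flow)

text \<open>The trajectories from \<open>(v, - G v)\<close> end with vanishing state, so their mutual symplectic products
  vanish.\<close>

lemma G_symmetric: "transpose G = G"
proof (rule matrix_eqI_inner)
  fix v w :: "real^'n"
  let ?z = "\<lambda>v. stack v (- G *v v)"
  have "upper (flow\<^sub>2 (?z v) T) = 0" for v
    using upper_terminal_stack[of v "- G"] by simp
  then have "symp (?z v) (?z w) = 0"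
    using symp_flow\<^sub>2[OF T_in, of "?z v" "?z w"] by (simp add: symp_def)
  then show "v \<bullet> (transpose G *v w) = v \<bullet> (G *v w)"
    unfolding inner_transpose by (simp add: symp_def mat_vec.minus_left)
qed

text \<open>The jump condition says that the jump carries the graph of
  \<open>P\<^sub>1 \<tau>\<close> into the graph of \<open>P\<^sub>2 \<tau>\<close>, which links the
  two invariance statements.\<close>

lemma hybrid_riccati_feedback:
  assumes P: "hybrid_riccati P\<^sub>1 P\<^sub>2" and init: "lower z = P\<^sub>1 0 *v upper z" and t: "t \<in> {\<tau>..T}"
  shows "lower (flow\<^sub>2 z t) = P\<^sub>2 t *v upper (flow\<^sub>2 z t)"
proof -
  have P': "m1.riccati P\<^sub>1" "m2.riccati P\<^sub>2" "P\<^sub>2 \<tau> = transpose (matrix_inv \<Xi>) ** P\<^sub>1 \<tau> ** matrix_inv \<Xi>"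
    using P by (auto simp: hybrid_riccati_def jump_condition_def matrix_inv_transpose[OF \<Xi>])
  have "lower (m1.flow z \<tau>) = P\<^sub>1 \<tau> *v upper (m1.flow z \<tau>)"
    using m1.riccati_trajectory[OF P'(1) m1.trajectory_flow _ \<tau>_in(1)] init by simp
  then have "lower (flow\<^sub>2 z \<tau>) = P\<^sub>2 \<tau> *v upper (flow\<^sub>2 z \<tau>)"
    using \<Xi> by (simp add: flow\<^sub>2_start lower_jump upper_jump P'(3) matrix_vector_mul_assoc)
      (simp flip: matrix_mul_assoc)
  then show ?thesis
    using m2.riccati_trajectory[OF P'(2) trajectory_flow\<^sub>2 _ t] by simp
qed

lemma hybrid_riccati_symmetric:
  assumes P: "hybrid_riccati P\<^sub>1 P\<^sub>2" and sym: "transpose (P\<^sub>1 0) = P\<^sub>1 0"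
  shows "t \<in> {0..\<tau>} \<Longrightarrow> transpose (P\<^sub>1 t) = P\<^sub>1 t" and "t \<in> {\<tau>..T} \<Longrightarrow> transpose (P\<^sub>2 t) = P\<^sub>2 t"
proof -
  have P': "m1.riccati P\<^sub>1" "m2.riccati P\<^sub>2" "P\<^sub>2 \<tau> = transpose (matrix_inv \<Xi>) ** P\<^sub>1 \<tau> ** matrix_inv \<Xi>"
    using P by (auto simp: hybrid_riccati_def jump_condition_def matrix_inv_transpose[OF \<Xi>])
  show *: "transpose (P\<^sub>1 t) = P\<^sub>1 t" if "t \<in> {0..\<tau>}" for t
    using m1.riccati_symmetric[OF P'(1) sym that] .
  have "transpose (P\<^sub>2 \<tau>) = P\<^sub>2 \<tau>"
    by (simp add: P'(3) matrix_transpose_mul matrix_mul_assoc *[OF \<tau>_in(1)])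
  then show "t \<in> {\<tau>..T} \<Longrightarrow> transpose (P\<^sub>2 t) = P\<^sub>2 t"
    using m2.riccati_symmetric[OF P'(2)] by blast
qed

text \<open>The closed-loop trajectory \<open>?z\<close> from \<open>v\<close> is compared with
  \<open>?w\<close>, which starts in state 0 with the costate that leads to the same terminal state.
  The form of \<open>P\<^sub>1 0 + G\<close> at \<open>v\<close> is their symplectic product, and at
  time \<open>T\<close> this is the gap of \<open>?w\<close>.\<close>

lemma hybrid_riccati_initial_nonpos:
  assumes P: "hybrid_riccati P\<^sub>1 P\<^sub>2" and sym: "transpose (P\<^sub>1 0) = P\<^sub>1 0"
  shows "v \<bullet> ((P\<^sub>1 0 + G) *v v) \<le> 0"
proof -
  let ?Z = "P\<^sub>1 0 + G"
  let ?z = "stack v (P\<^sub>1 0 *v v)" and ?w = "stack 0 (?Z *v v)"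
  let ?gap = "\<lambda>P z. upper z \<bullet> (lower z - P *v upper z)"
  have P': "m1.riccati P\<^sub>1" "m2.riccati P\<^sub>2" "P\<^sub>2 \<tau> = transpose (matrix_inv \<Xi>) ** P\<^sub>1 \<tau> ** matrix_inv \<Xi>"
    using P by (auto simp: hybrid_riccati_def jump_condition_def matrix_inv_transpose[OF \<Xi>])
  \<comment> \<open>The gap decreases weakly in each mode, is kept by the jump, and is 0 at the
    start because the state of \<open>?w\<close> is.\<close>
  have "?gap (P\<^sub>2 T) (flow\<^sub>2 ?w T) \<le> ?gap (P\<^sub>2 \<tau>) (flow\<^sub>2 ?w \<tau>)"
    using m2.riccati_gap_antimono[OF P'(2) hybrid_riccati_symmetric(2)[OF P sym] trajectory_flow\<^sub>2 T_in] .
  also have "\<dots> = ?gap (P\<^sub>1 \<tau>) (m1.flow ?w \<tau>)"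
  proof -
    have "P\<^sub>2 \<tau> *v upper (flow\<^sub>2 ?w \<tau>) = transpose (matrix_inv \<Xi>) *v (P\<^sub>1 \<tau> *v upper (m1.flow ?w \<tau>))"
      using \<Xi> by (simp add: flow\<^sub>2_start upper_jump P'(3) matrix_vector_mul_assoc) (simp flip: matrix_mul_assoc)
    then have "lower (flow\<^sub>2 ?w \<tau>) - P\<^sub>2 \<tau> *v upper (flow\<^sub>2 ?w \<tau>)
        = transpose (matrix_inv \<Xi>) *v (lower (m1.flow ?w \<tau>) - P\<^sub>1 \<tau> *v upper (m1.flow ?w \<tau>))"
      by (simp add: flow\<^sub>2_start lower_jump mat_vec.diff_right)
    then show ?thesis
      using \<Xi> by (simp add: flow\<^sub>2_start upper_jump inner_transpose matrix_vector_mul_assoc)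
  qed
  also have "\<dots> \<le> ?gap (P\<^sub>1 0) (m1.flow ?w 0)"
    using m1.riccati_gap_antimono[OF P'(1) hybrid_riccati_symmetric(1)[OF P sym] m1.trajectory_flow \<tau>_in(1)] .
  also have "\<dots> = 0" by simp
  finally have "?gap (P\<^sub>2 T) (flow\<^sub>2 ?w T) \<le> 0" .
  \<comment> \<open>Both end in the same state \<open>x\<close>, and \<open>?z\<close> has costate
    \<open>P\<^sub>2 T *v x\<close> there, so the gap of \<open>?w\<close> equals the symplectic
    product.\<close>
  moreover have "upper (flow\<^sub>2 ?w T) = upper (flow\<^sub>2 ?z T)"
    unfolding upper_terminal_stack by (simp add: upper_terminal)
  moreover have "lower (flow\<^sub>2 ?z T) = P\<^sub>2 T *v upper (flow\<^sub>2 ?z T)"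
    by (rule hybrid_riccati_feedback[OF P _ T_in]) simp
  ultimately have "symp (flow\<^sub>2 ?z T) (flow\<^sub>2 ?w T) \<le> 0"
    by (simp add: symp_def inner_diff_right inner_commute)
  then have "symp ?z ?w \<le> 0" by (simp only: symp_flow\<^sub>2[OF T_in])
  then show ?thesis by (simp add: symp_def)
qed

text \<open>The symplectic product of a closed-loop trajectory of \<open>P\<close> with one of
  \<open>K\<close> is minus the bilinear form of \<open>P - K\<close> at their states; it is the
  same at times 0 and \<open>T\<close>.\<close>

lemma hybrid_riccati_difference:
  assumes P: "hybrid_riccati P\<^sub>1 P\<^sub>2" and K: "hybrid_riccati K\<^sub>1 K\<^sub>2" and sym: "transpose (P\<^sub>1 0) = P\<^sub>1 0"
  shows "transpose (P\<^sub>1 0 + G) ** (transpose F12 ** (P\<^sub>2 T - K\<^sub>2 T) ** F12) ** (K\<^sub>1 0 + G) = P\<^sub>1 0 - K\<^sub>1 0"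
proof (rule matrix_eqI_inner)
  fix v w :: "real^'n"
  let ?z = "flow\<^sub>2 (stack v (P\<^sub>1 0 *v v)) T" and ?y = "flow\<^sub>2 (stack w (K\<^sub>1 0 *v w)) T"
  have z: "lower ?z = P\<^sub>2 T *v upper ?z" and y: "lower ?y = K\<^sub>2 T *v upper ?y"
    by (rule hybrid_riccati_feedback[OF P _ T_in] hybrid_riccati_feedback[OF K _ T_in]; simp)+
  have "v \<bullet> (transpose (P\<^sub>1 0 + G) ** (transpose F12 ** (P\<^sub>2 T - K\<^sub>2 T) ** F12) ** (K\<^sub>1 0 + G) *v w)
      = (F12 *v ((P\<^sub>1 0 + G) *v v)) \<bullet> ((P\<^sub>2 T - K\<^sub>2 T) *v (F12 *v ((K\<^sub>1 0 + G) *v w)))"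
    by (simp add: inner_transpose flip: matrix_vector_mul_assoc)
  also have "\<dots> = upper ?z \<bullet> ((P\<^sub>2 T - K\<^sub>2 T) *v upper ?y)"
    by (simp add: upper_terminal_stack)
  also have "\<dots> = - symp ?z ?y"
    by (simp add: symp_def z y mat_vec.diff_left inner_diff_right
        inner_symmetric_matrix[OF hybrid_riccati_symmetric(2)[OF P sym T_in]])
  also have "\<dots> = - symp (stack v (P\<^sub>1 0 *v v)) (stack w (K\<^sub>1 0 *v w))"
    by (simp only: symp_flow\<^sub>2[OF T_in])
  also have "\<dots> = v \<bullet> ((P\<^sub>1 0 - K\<^sub>1 0) *v w)"
    by (simp add: symp_def mat_vec.diff_left inner_diff_right inner_symmetric_matrix[OF sym])
  finally show "v \<bullet> (transpose (P\<^sub>1 0 + G) ** (transpose F12 ** (P\<^sub>2 T - K\<^sub>2 T) ** F12) ** (K\<^sub>1 0 + G) *v w)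
    = v \<bullet> ((P\<^sub>1 0 - K\<^sub>1 0) *v w)" .
qed

text \<open>If \<open>z\<close> has state 0, its product with \<open>w\<close> is the pairing of
  \<open>z - w\<close> minus the pairing of \<open>w\<close>.\<close>

lemma symp_nonneg_at_zero_state:
  assumes "upper z = 0" and "upper w \<bullet> lower w \<le> 0"
    and "0 \<le> upper (z - w) \<bullet> lower (z - w)"
  shows "0 \<le> symp z w"
  using assms by (simp add: symp_def upper_diff lower_diff inner_diff_right inner_commute)

section \<open>Existence of the Riccati solution on the whole window\<close>

context
  fixes P :: "real^'n^'n"
  assumes Q\<^sub>1: "\<And>t. t \<in> {0..\<tau>} \<Longrightarrow> pos_semidef (Q\<^sub>1 t)" and Q\<^sub>2: "\<And>t. t \<in> {\<tau>..T} \<Longrightarrow> pos_semidef (Q\<^sub>2 t)"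
    and neg: "\<And>v. v \<noteq> 0 \<Longrightarrow> v \<bullet> ((P + G) *v v) < 0"
begin

lemma inner_flow\<^sub>2_antimono:
  "\<tau> \<le> s \<Longrightarrow> s \<le> t \<Longrightarrow> t \<le> T \<Longrightarrow> upper (flow\<^sub>2 z t) \<bullet> lower (flow\<^sub>2 z t) \<le> upper (flow\<^sub>2 z s) \<bullet> lower (flow\<^sub>2 z s)"
  by (rule m2.inner_trajectory_antimono[OF trajectory_flow\<^sub>2 Q\<^sub>2])

lemma inner_flow_antimono:
  "0 \<le> s \<Longrightarrow> s \<le> t \<Longrightarrow> t \<le> \<tau> \<Longrightarrow> upper (m1.flow z t) \<bullet> lower (m1.flow z t) \<le> upper (m1.flow z s) \<bullet> lower (m1.flow z s)"
  by (rule m1.inner_trajectory_antimono[OF m1.trajectory_flow Q\<^sub>1])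

lemma inner_flow\<^sub>2_start: "upper (flow\<^sub>2 z \<tau>) \<bullet> lower (flow\<^sub>2 z \<tau>) = upper (m1.flow z \<tau>) \<bullet> lower (m1.flow z \<tau>)"
  by (simp add: flow\<^sub>2_start inner_jump)

text \<open>The closed-loop trajectory \<open>?z\<close> is compared with the trajectory \<open>?w\<close> that starts with zero
  state and ends in the same state as \<open>?z\<close>.  Their symplectic product is negative, whereas
  monotonicity of the pairing along \<open>?w\<close> and \<open>?z - ?w\<close> makes it nonnegative at any zero of the
  state of \<open>?z\<close>.\<close>

lemma closed_loop_state_nonzero:
  fixes v :: "real^'n"
  assumes v: "v \<noteq> 0"
  shows "t \<in> {0..\<tau>} \<Longrightarrow> upper (m1.flow (stack v (P *v v)) t) \<noteq> 0"
    and "t \<in> {\<tau>..T} \<Longrightarrow> upper (flow\<^sub>2 (stack v (P *v v)) t) \<noteq> 0"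
proof -
  let ?z = "stack v (P *v v)" and ?w = "stack 0 ((P + G) *v v)"
  have T: "upper (flow\<^sub>2 (?z - ?w) T) = 0"
    unfolding flow\<^sub>2_diff upper_diff upper_terminal_stack by (simp add: upper_terminal)
  have symp: "symp ?z ?w < 0" using neg[OF v] by (simp add: symp_def)
  {
    assume t: "t \<in> {0..\<tau>}"
    have "upper (m1.flow ?w t) \<bullet> lower (m1.flow ?w t) \<le> 0"
      using inner_flow_antimono[of 0 t ?w] t by simp
    moreover have "0 \<le> upper (m1.flow (?z - ?w) t) \<bullet> lower (m1.flow (?z - ?w) t)"
      using inner_flow_antimono[of t \<tau> "?z - ?w"] inner_flow\<^sub>2_antimono[of \<tau> T "?z - ?w"]
        inner_flow\<^sub>2_start[of "?z - ?w"] T t m2.ab by simp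
    ultimately show "upper (m1.flow ?z t) \<noteq> 0"
      using symp_nonneg_at_zero_state[of "m1.flow ?z t" "m1.flow ?w t"] symp symp_flow[OF t, of ?z ?w]
      by (auto simp: m1.flow_diff)
  next
    assume t: "t \<in> {\<tau>..T}"
    have "upper (flow\<^sub>2 ?w t) \<bullet> lower (flow\<^sub>2 ?w t) \<le> 0"
      using inner_flow\<^sub>2_antimono[of \<tau> t ?w] inner_flow\<^sub>2_start[of ?w] inner_flow_antimono[of 0 \<tau> ?w] t m1.ab by simp
    moreover have "0 \<le> upper (flow\<^sub>2 (?z - ?w) t) \<bullet> lower (flow\<^sub>2 (?z - ?w) t)"
      using inner_flow\<^sub>2_antimono[of t T "?z - ?w"] T t by simp
    ultimately show "upper (flow\<^sub>2 ?z t) \<noteq> 0"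
      using symp_nonneg_at_zero_state[of "flow\<^sub>2 ?z t" "flow\<^sub>2 ?w t"] symp symp_flow\<^sub>2[OF t, of ?z ?w]
      by (auto simp: flow\<^sub>2_diff)
  }
qed

text \<open>The closed-loop state matrices are injective at all times, so the quotient of costate
  and state blocks is defined throughout both modes.\<close>

lemma hybrid_riccati_exists: "\<exists>P\<^sub>1 P\<^sub>2. hybrid_riccati P\<^sub>1 P\<^sub>2 \<and> P\<^sub>1 0 = P"
proof -
  let ?S = "stack (mat 1) P :: real^'n^('n + 'n)"
  let ?J = "block_matrix \<Xi> 0 0 (matrix_inv (transpose \<Xi>))"
  let ?N = "\<lambda>t. \<Phi>\<^sub>1 t 0 ** ?S"
  let ?M = "\<lambda>t. \<Phi>\<^sub>2 t \<tau> ** (?J ** ?N \<tau>)"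
  let ?P\<^sub>1 = "\<lambda>t. lower (?N t) ** matrix_inv (upper (?N t))"
  let ?P\<^sub>2 = "\<lambda>t. lower (?M t) ** matrix_inv (upper (?M t))"
  have N: "upper (?N t) *v v = upper (m1.flow (stack v (P *v v)) t)" for t v
    by (simp add: m1.flow_def stack_matrix_vector flip: upper_matrix_vector_mult matrix_vector_mul_assoc)
  have M: "upper (?M t) *v v = upper (flow\<^sub>2 (stack v (P *v v)) t)" for t v
    by (simp add: flow\<^sub>2_def jump_def m1.flow_def m2.flow_def stack_matrix_vector
        flip: upper_matrix_vector_mult matrix_vector_mul_assoc)
  have invN: "invertible (upper (?N t))" if "t \<in> {0..\<tau>}" for t
    by (rule invertible_if_ker_trivial) (use closed_loop_state_nonzero(1)[OF _ that] N in metis)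
  have invM: "invertible (upper (?M t))" if "t \<in> {\<tau>..T}" for t
    by (rule invertible_if_ker_trivial) (use closed_loop_state_nonzero(2)[OF _ that] M in metis)
  have "\<Phi>\<^sub>1 0 0 = mat 1" "\<Phi>\<^sub>2 \<tau> \<tau> = mat 1"
    using m1.kernel m2.kernel m1.ab m2.ab by (simp_all add: transition_kernel_def)
  then have start: "?N 0 = ?S" "?M \<tau> = ?J ** ?N \<tau>" by simp_all
  have "?P\<^sub>1 0 = P"
    by (simp add: start matrix_inv_unique[of "mat 1" "mat 1"])
  \<comment> \<open>The jump multiplies the costate block by the inverse transpose of
    \<open>\<Xi>\<close> and the state block by \<open>\<Xi>\<close>; their quotient then transforms
    as the jump condition demands.\<close>
  moreover have "jump_condition \<Xi> (?P\<^sub>1 \<tau>) (?P\<^sub>2 \<tau>)"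
  proof -
    let ?X = "upper (?N \<tau>)"
    have "(\<Xi> ** ?X) ** (matrix_inv ?X ** matrix_inv \<Xi>) = \<Xi> ** (?X ** matrix_inv ?X) ** matrix_inv \<Xi>"
      by (simp only: matrix_mul_assoc)
    also have "\<dots> = mat 1"
      using invN[OF \<tau>_in(1)] \<Xi> by simp
    finally have "matrix_inv (\<Xi> ** ?X) = matrix_inv ?X ** matrix_inv \<Xi>"
      by (rule matrix_inv_unique)
    then show ?thesis
      unfolding jump_condition_def start(2) by (simp add: upper_block_matrix_mult lower_block_matrix_mult)
        (simp add: matrix_mul_assoc)
  qed
  moreover have "m1.riccati ?P\<^sub>1" using m1.riccati_quotient[OF invN] .
  moreover have "m2.riccati ?P\<^sub>2" using m2.riccati_quotient[OF invM] .
  ultimately show ?thesis unfolding hybrid_riccati_def by blast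
qed

end

section \<open>The boundary conditions and the initial values\<close>

lemma hybrid_riccati_flow_iff:
  "hybrid_riccati_flow \<tau> T \<Xi> A\<^sub>1 B\<^sub>1 Q\<^sub>1 A\<^sub>2 B\<^sub>2 Q\<^sub>2 P\<^sub>1 H\<^sub>1 P\<^sub>2 H\<^sub>2 \<longleftrightarrow>
    hybrid_riccati P\<^sub>1 P\<^sub>2 \<and> hybrid_riccati (\<lambda>t. - H\<^sub>1 t) (\<lambda>t. - H\<^sub>2 t)"
  by (auto simp: hybrid_riccati_flow_def hybrid_riccati_def m1.riccati_pair_on_iff m2.riccati_pair_on_iff
      jump_condition_def mat_mult.minus_left mat_mult.minus_right)

context
  fixes \<Sigma>\<^sub>0 \<Sigma>\<^sub>T :: "real^'n^'n"
  assumes \<Sigma>\<^sub>0: "pos_def \<Sigma>\<^sub>0" and \<Sigma>\<^sub>T: "pos_def \<Sigma>\<^sub>T"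
begin

text \<open>The terminal covariance pulled back along \<open>F12\<close>; it is the constant term
  \<open>C\<close> of the quadratic equation.\<close>

abbreviation terminal_gain :: "real^'n^'n" where
  "terminal_gain \<equiv> matrix_inv F12 ** \<Sigma>\<^sub>T ** matrix_inv (transpose F12)"

interpretation quadratic_matrix_equation \<Sigma>\<^sub>0 terminal_gain
proof
  show "pos_def terminal_gain"
    using pos_def_congruence[OF \<Sigma>\<^sub>T invertible_matrix_inv[OF F12]] by (simp add: matrix_inv_transpose[OF F12])
qed (rule \<Sigma>\<^sub>0)

definition initial_riccati :: "real^'n^'n" where
  "initial_riccati = (1/2) *\<^sub>R matrix_inv \<Sigma>\<^sub>0 - G
     - matrix_inv (msqrt \<Sigma>\<^sub>0)
       ** msqrt ((1/4) *\<^sub>R mat 1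
            + msqrt \<Sigma>\<^sub>0 ** matrix_inv F12 ** \<Sigma>\<^sub>T ** matrix_inv (transpose F12) ** msqrt \<Sigma>\<^sub>0)
       ** matrix_inv (msqrt \<Sigma>\<^sub>0)"

text \<open>The claimed initial value is the distinguished root of the quadratic equation shifted by
  \<open>- G\<close>; reassociation reconciles the two groupings under the root.\<close>

lemma eq_initial_riccati_iff:
  "P = initial_riccati \<longleftrightarrow>
    P + G = (1/2) *\<^sub>R matrix_inv \<Sigma>\<^sub>0 - matrix_inv (msqrt \<Sigma>\<^sub>0)
      ** msqrt ((1/4) *\<^sub>R mat 1 + msqrt \<Sigma>\<^sub>0 ** terminal_gain ** msqrt \<Sigma>\<^sub>0) ** matrix_inv (msqrt \<Sigma>\<^sub>0)"
  unfolding initial_riccati_def matrix_mul_assoc by (auto simp: algebra_simps)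

lemma solves_iff:
  "solves_hybrid_covariance_steering \<tau> T \<Xi> A\<^sub>1 B\<^sub>1 Q\<^sub>1 A\<^sub>2 B\<^sub>2 Q\<^sub>2 \<Sigma>\<^sub>0 \<Sigma>\<^sub>T P\<^sub>1 H\<^sub>1 P\<^sub>2 H\<^sub>2 \<longleftrightarrow>
    hybrid_riccati_flow \<tau> T \<Xi> A\<^sub>1 B\<^sub>1 Q\<^sub>1 A\<^sub>2 B\<^sub>2 Q\<^sub>2 P\<^sub>1 H\<^sub>1 P\<^sub>2 H\<^sub>2 \<and>
    P\<^sub>1 0 = initial_riccati \<and> H\<^sub>1 0 = matrix_inv \<Sigma>\<^sub>0 - P\<^sub>1 0"
  (is "?solves \<longleftrightarrow> ?flow \<and> ?P \<and> ?H")
proof -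
  let ?Z = "P\<^sub>1 0 + G"
  \<comment> \<open>The difference identity is applied to \<open>P\<close> and
    \<open>K = - H\<close>: at time 0 their difference is the inverse of
    \<open>\<Sigma>\<^sub>0\<close>, so that \<open>K\<^sub>1 0 + G\<close> is
    \<open>?Z - matrix_inv \<Sigma>\<^sub>0\<close>, and at time \<open>T\<close> it is
    \<open>P\<^sub>2 T + H\<^sub>2 T\<close>.\<close>
  have terminal: "matrix_inv \<Sigma>\<^sub>T = P\<^sub>2 T + H\<^sub>2 T \<longleftrightarrow> ?Z ** \<Sigma>\<^sub>0 ** ?Z - ?Z = terminal_gain"
    if flow: "?flow" and H: "?H" and sym: "transpose (P\<^sub>1 0) = P\<^sub>1 0"
  proof (rule terminal_covariance_iff)
    show "?Z ** (transpose F12 ** (P\<^sub>2 T + H\<^sub>2 T) ** F12) ** (?Z - matrix_inv \<Sigma>\<^sub>0) = matrix_inv \<Sigma>\<^sub>0"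
      using hybrid_riccati_difference[of P\<^sub>1 P\<^sub>2 "\<lambda>t. - H\<^sub>1 t" "\<lambda>t. - H\<^sub>2 t"] flow sym
      by (simp add: hybrid_riccati_flow_iff H sym transpose_add G_symmetric diff_add_eq)
  qed (use \<Sigma>\<^sub>0 \<Sigma>\<^sub>T F12 in \<open>auto intro: pos_def_imp_invertible\<close>)
  show ?thesis
  proof (intro iffI conjI)
    assume s: ?solves
    show flow: ?flow using s by (simp add: solves_hybrid_covariance_steering_def)
    show H: ?H using s by (simp add: solves_hybrid_covariance_steering_def)
    have sym: "transpose (P\<^sub>1 0) = P\<^sub>1 0"
      using s m1.ab by (simp add: solves_hybrid_covariance_steering_def)
    have "?Z ** \<Sigma>\<^sub>0 ** ?Z - ?Z = terminal_gain"
      using terminal[OF flow H sym] s by (simp add: solves_hybrid_covariance_steering_def)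
    moreover have "transpose ?Z = ?Z" by (simp add: transpose_add sym G_symmetric)
    \<comment> \<open>Existence of the solution up to time \<open>T\<close> supplies the sign that
      selects the principal root.\<close>
    moreover have "v \<bullet> (?Z *v v) \<le> 0" for v
      using hybrid_riccati_initial_nonpos[of P\<^sub>1 P\<^sub>2] sym flow by (simp add: hybrid_riccati_flow_iff)
    ultimately show ?P unfolding eq_initial_riccati_iff by (rule nonpos_root_eq)
  next
    assume "?flow \<and> ?P \<and> ?H"
    then have flow: ?flow and P: ?P and H: ?H by auto
    note root = P[unfolded eq_initial_riccati_iff]
    \<comment> \<open>Symmetry is read off from the closed formula at time 0 and then propagated
      along the Riccati flow.\<close>
    have "P\<^sub>1 0 = ?Z - G" by simp
    then have sym: "transpose (P\<^sub>1 0) = P\<^sub>1 0"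
      by (metis transpose_diff root_symmetric[OF root] G_symmetric)
    have inv: "transpose (matrix_inv \<Sigma>\<^sub>0) = matrix_inv \<Sigma>\<^sub>0"
      using pos_def_matrix_inv[OF \<Sigma>\<^sub>0] by (simp add: pos_def_def)
    have symH: "transpose (- H\<^sub>1 0) = - H\<^sub>1 0"
      by (simp add: H transpose_diff sym inv)
    have ric: "hybrid_riccati P\<^sub>1 P\<^sub>2" "hybrid_riccati (\<lambda>t. - H\<^sub>1 t) (\<lambda>t. - H\<^sub>2 t)"
      using flow by (simp_all add: hybrid_riccati_flow_iff)
    have "matrix_inv \<Sigma>\<^sub>T = P\<^sub>2 T + H\<^sub>2 T"
      using terminal[OF flow H sym] root_equation[OF root] by simp
    then show ?solves
      using flow hybrid_riccati_symmetric[OF ric(1) sym] hybrid_riccati_symmetric[OF ric(2) symH]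
      by (simp add: solves_hybrid_covariance_steering_def H transpose_uminus)
  qed
qed

text \<open>Negative definiteness of the root covers the start value of \<open>P\<close>;
  subtracting the positive definite inverse of \<open>\<Sigma>\<^sub>0\<close> keeps it for
  \<open>K = - H\<close>. So both Riccati solutions exist on the whole window.\<close>

lemma solution_exists:
  assumes "\<And>t. t \<in> {0..\<tau>} \<Longrightarrow> pos_semidef (Q\<^sub>1 t)" and "\<And>t. t \<in> {\<tau>..T} \<Longrightarrow> pos_semidef (Q\<^sub>2 t)"
  shows "\<exists>P\<^sub>1 H\<^sub>1 P\<^sub>2 H\<^sub>2. solves_hybrid_covariance_steering \<tau> T \<Xi> A\<^sub>1 B\<^sub>1 Q\<^sub>1 A\<^sub>2 B\<^sub>2 Q\<^sub>2 \<Sigma>\<^sub>0 \<Sigma>\<^sub>T P\<^sub>1 H\<^sub>1 P\<^sub>2 H\<^sub>2"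
proof -
  let ?P = initial_riccati and ?K = "initial_riccati - matrix_inv \<Sigma>\<^sub>0"
  note root = eq_initial_riccati_iff[THEN iffD1, OF refl]
  have neg: "v \<bullet> ((?P + G) *v v) < 0" if "v \<noteq> 0" for v
    using root_neg_def[OF root that] .
  have "v \<bullet> ((?K + G) *v v) < 0" if v: "v \<noteq> 0" for v
  proof -
    have "0 < v \<bullet> (matrix_inv \<Sigma>\<^sub>0 *v v)"
      using pos_def_matrix_inv[OF \<Sigma>\<^sub>0] v by (simp add: pos_def_def)
    then show ?thesis
      using neg[OF v] by (simp add: mat_vec.add_left mat_vec.diff_left inner_add_right inner_diff_right)
  qed
  then obtain K\<^sub>1 K\<^sub>2 where K: "hybrid_riccati K\<^sub>1 K\<^sub>2" "K\<^sub>1 0 = ?K"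
    using hybrid_riccati_exists[OF assms] by blast
  obtain P\<^sub>1 P\<^sub>2 where P: "hybrid_riccati P\<^sub>1 P\<^sub>2" "P\<^sub>1 0 = ?P"
    using hybrid_riccati_exists[OF assms neg] by blast
  have "solves_hybrid_covariance_steering \<tau> T \<Xi> A\<^sub>1 B\<^sub>1 Q\<^sub>1 A\<^sub>2 B\<^sub>2 Q\<^sub>2 \<Sigma>\<^sub>0 \<Sigma>\<^sub>T
      P\<^sub>1 (\<lambda>t. - K\<^sub>1 t) P\<^sub>2 (\<lambda>t. - K\<^sub>2 t)"
    using P K by (simp add: solves_iff hybrid_riccati_flow_iff)
  then show ?thesis by blast
qed

end

end

theorem theorem1:
  fixes A\<^sub>1 A\<^sub>2 Q\<^sub>1 Q\<^sub>2 :: "real \<Rightarrow> real^'n^'n"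
    and B\<^sub>1 :: "real \<Rightarrow> real^'p^'n" and B\<^sub>2 :: "real \<Rightarrow> real^'q^'n"
    and \<Xi> \<Sigma>\<^sub>0 \<Sigma>\<^sub>T F11 F12 :: "real^'n^'n"
    and \<Phi>\<^sub>1 \<Phi>\<^sub>2 :: "real \<Rightarrow> real \<Rightarrow> real^('n + 'n)^('n + 'n)"
    and \<tau> T :: real
  assumes "0 < \<tau>" and "\<tau> < T"
    and "continuous_on {0..\<tau>} A\<^sub>1" and "continuous_on {0..\<tau>} B\<^sub>1" and "continuous_on {0..\<tau>} Q\<^sub>1"
    and "continuous_on {\<tau>..T} A\<^sub>2" and "continuous_on {\<tau>..T} B\<^sub>2" and "continuous_on {\<tau>..T} Q\<^sub>2"
    and "\<And>t. t \<in> {0..\<tau>} \<Longrightarrow> transpose (Q\<^sub>1 t) = Q\<^sub>1 t"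
    and "\<And>t. t \<in> {\<tau>..T} \<Longrightarrow> transpose (Q\<^sub>2 t) = Q\<^sub>2 t"
    and "invertible \<Xi>"
    and "pos_def \<Sigma>\<^sub>0" and "pos_def \<Sigma>\<^sub>T"
    and "transition_kernel {0..\<tau>} (hamiltonian_matrix A\<^sub>1 B\<^sub>1 Q\<^sub>1) \<Phi>\<^sub>1"
    and "transition_kernel {\<tau>..T} (hamiltonian_matrix A\<^sub>2 B\<^sub>2 Q\<^sub>2) \<Phi>\<^sub>2"
    and "F11 = block11 (hybrid_transition_kernel \<tau> \<Xi> \<Phi>\<^sub>1 \<Phi>\<^sub>2 T)"
    and "F12 = block12 (hybrid_transition_kernel \<tau> \<Xi> \<Phi>\<^sub>1 \<Phi>\<^sub>2 T)"
    and "invertible F12"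
  shows "(\<forall>P\<^sub>1 H\<^sub>1 P\<^sub>2 H\<^sub>2.
            solves_hybrid_covariance_steering \<tau> T \<Xi> A\<^sub>1 B\<^sub>1 Q\<^sub>1 A\<^sub>2 B\<^sub>2 Q\<^sub>2 \<Sigma>\<^sub>0 \<Sigma>\<^sub>T P\<^sub>1 H\<^sub>1 P\<^sub>2 H\<^sub>2 \<longleftrightarrow>
            hybrid_riccati_flow \<tau> T \<Xi> A\<^sub>1 B\<^sub>1 Q\<^sub>1 A\<^sub>2 B\<^sub>2 Q\<^sub>2 P\<^sub>1 H\<^sub>1 P\<^sub>2 H\<^sub>2 \<and>
            P\<^sub>1 0 = (1/2) *\<^sub>R matrix_inv \<Sigma>\<^sub>0 - matrix_inv F12 ** F11
              - matrix_inv (msqrt \<Sigma>\<^sub>0)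
                ** msqrt ((1/4) *\<^sub>R mat 1
                     + msqrt \<Sigma>\<^sub>0 ** matrix_inv F12 ** \<Sigma>\<^sub>T ** matrix_inv (transpose F12) ** msqrt \<Sigma>\<^sub>0)
                ** matrix_inv (msqrt \<Sigma>\<^sub>0) \<and>
            H\<^sub>1 0 = matrix_inv \<Sigma>\<^sub>0 - P\<^sub>1 0)
       \<and> ((\<forall>t\<in>{0..\<tau>}. pos_semidef (Q\<^sub>1 t)) \<and> (\<forall>t\<in>{\<tau>..T}. pos_semidef (Q\<^sub>2 t)) \<longrightarrow>
            (\<exists>P\<^sub>1 H\<^sub>1 P\<^sub>2 H\<^sub>2.
               solves_hybrid_covariance_steering \<tau> T \<Xi> A\<^sub>1 B\<^sub>1 Q\<^sub>1 A\<^sub>2 B\<^sub>2 Q\<^sub>2 \<Sigma>\<^sub>0 \<Sigma>\<^sub>T P\<^sub>1 H\<^sub>1 P\<^sub>2 H\<^sub>2))"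
proof -
  interpret hybrid_system \<tau> T A\<^sub>1 A\<^sub>2 Q\<^sub>1 Q\<^sub>2 B\<^sub>1 B\<^sub>2 \<Phi>\<^sub>1 \<Phi>\<^sub>2 \<Xi> F11 F12
    by unfold_locales (use assms in blast)+
  show ?thesis
    using solves_iff[OF \<open>pos_def \<Sigma>\<^sub>0\<close> \<open>pos_def \<Sigma>\<^sub>T\<close>, unfolded initial_riccati_def[OF \<open>pos_def \<Sigma>\<^sub>0\<close> \<open>pos_def \<Sigma>\<^sub>T\<close>]]
      solution_exists[OF \<open>pos_def \<Sigma>\<^sub>0\<close> \<open>pos_def \<Sigma>\<^sub>T\<close>]
    by (intro conjI allI impI) blast+
qed

end
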